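(* For any geodesic space $X$ and $\delta=\frac{3\varepsilon}{2}>0$, there is an equivalence of the covering maps $\pi^\delta:\widetilde X^\delta\to X$ and $\phi_\varepsilon:X_\varepsilon\to X$ (hence an isometry) $h:\widetilde X^\delta\to X_\varepsilon$.
   Context: A geodesic space is a metric space in which any two points are joined by a path whose length equals their distance. Fix a base point $*\in X$. The cover $X_\varepsilon$. For $\varepsilon>0$, an $\varepsilon$-chain is a finite sequence $\{x_0,\dots,x_n\}$ with $d(x_i,x_{i+1})<\varepsilon$ for all $i$. An $\varepsilon$-homotopy is a finite sequence of $\varepsilon$-chains, each obtained from its predecessor by adding or removing a single point, endpoints always fixed; $[\alpha]_\varepsilon$ is the $\varepsilon$-homotopy class of $\alpha$. $X_\varepsilon$ is the set of all $[\alpha]_\varepsilon$ with $\alpha$ an $\varepsilon$-chain starting at $*$, with metric $d([\alpha]_\varepsilon,[\beta]_\varepsilon)=\inf\{L(\gamma):\gamma\in[\overline\alpha*\beta]_\varepsilon\}$, where $L(\{x_0,\dots,x_n\})=\sum_i d(x_{i-1},x_i)$, $\overline\alpha$ is the reversal and $*$ between chains is concatenation. $\phi_\varepsilon:X_\varepsilon\to X$ is the endpoint map, a regular covering map; on a geodesic space this metric coincides with the lifted geodesic metric. The cover $\widetilde X^\delta$. Let $S_\delta\subset\pi_1(X,* )$ be the subgroup generated by classes of all loops $c*L*\overline c$, where $c$ is a path starting at $*$, $\overline c$ its reversal, and $L$ is a loop at the endpoint of $c$ lying entirely in some open ball of radius $\delta$ in $X$. $\pi^\delta:\widetilde X^\delta\to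 X$ is the (connected) covering map characterized by: a loop at $*$ lifts to a loop at the base point of $\widetilde X^\delta$ if and only if its class lies in $S_\delta$. $\widetilde X^\delta$ carries the lifted geodesic metric $d(x,y)=\inf\{L(\pi^\delta\circ c):c\text{ a path joining }x\text{ and }y\}$. An equivalence of these covering maps is a homeomorphism $h:\widetilde X^\delta\to X_\varepsilon$ with $\phi_\varepsilon\circ h=\pi^\delta$. *)

theory Defs
  imports "HOL-Analysis.Analysis" "HOL-Algebra.Generated_Groups"
begin

section \<open>Chains, lengths and geodesic spaces\<close>

definition chain_length :: "'a::metric_space list \<Rightarrow> real" where
  "chain_length xs = (\<Sum>i<length xs - 1. dist (xs ! i) (xs ! Suc i))"

text \<open>Lengths of paths are extended reals, since a path need not be rectifiable.\<close>

definition path_length :: "(real \<Rightarrow> 'a::metric_space) \<Rightarrow> ennreal" where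
  "path_length g = (SUP ts \<in> {ts. sorted ts \<and> set ts \<subseteq> {0..1}}. ennreal (chain_length (map g ts)))"

definition geodesic_space :: "'a::metric_space set \<Rightarrow> bool" where
  "geodesic_space X \<longleftrightarrow>
     (\<forall>x\<in>X. \<forall>y\<in>X. \<exists>g. path g \<and> path_image g \<subseteq> X \<and> pathstart g = x \<and> pathfinish g = y \<and>
        path_length g = ennreal (dist x y))"


section \<open>The cover by classes of chains\<close>

definition eps_chain :: "'a::metric_space set \<Rightarrow> real \<Rightarrow> 'a list \<Rightarrow> bool" where
  "eps_chain X \<epsilon> xs \<longleftrightarrow> xs \<noteq> [] \<and> set xs \<subseteq> X \<and> successively (\<lambda>x y. dist x y < \<epsilon>) xs"

definition add_point :: "'a::metric_space set \<Rightarrow> real \<Rightarrow> 'a list \<Rightarrow> 'a list \<Rightarrow> bool" where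
  "add_point X \<epsilon> xs ys \<longleftrightarrow> eps_chain X \<epsilon> xs \<and> eps_chain X \<epsilon> ys \<and>
     hd xs = hd ys \<and> last xs = last ys \<and>
     (\<exists>us x vs. xs = us @ vs \<and> ys = us @ x # vs)"

definition eps_homotopic :: "'a::metric_space set \<Rightarrow> real \<Rightarrow> 'a list \<Rightarrow> 'a list \<Rightarrow> bool" where
  "eps_homotopic X \<epsilon> = (\<lambda>xs ys. add_point X \<epsilon> xs ys \<or> add_point X \<epsilon> ys xs)\<^sup>*\<^sup>*"

definition eps_class :: "'a::metric_space set \<Rightarrow> real \<Rightarrow> 'a list \<Rightarrow> 'a list set" where
  "eps_class X \<epsilon> \<alpha> = {\<beta>. eps_homotopic X \<epsilon> \<alpha> \<beta>}"

definition eps_cover :: "'a::metric_space set \<Rightarrow> real \<Rightarrow> 'a \<Rightarrow> 'a list set set" where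
  "eps_cover X \<epsilon> b = {eps_class X \<epsilon> \<alpha> | \<alpha>. eps_chain X \<epsilon> \<alpha> \<and> hd \<alpha> = b}"

text \<open>
  The chain \<open>rev \<alpha> @ tl \<beta>\<close> is the concatenation of the reversal of \<open>\<alpha>\<close> with \<open>\<beta>\<close>, the common
  point being listed once; its class does not depend on the chosen representatives.  The value 0
  outside the cover is only there because the locale \<open>Metric_space\<close> asks for a symmetric
  nonnegative function on the whole type.
\<close>

definition eps_dist :: "'a::metric_space set \<Rightarrow> real \<Rightarrow> 'a \<Rightarrow> 'a list set \<Rightarrow> 'a list set \<Rightarrow> real" where
  "eps_dist X \<epsilon> b A B =
     (if A \<in> eps_cover X \<epsilon> b \<and> B \<in> eps_cover X \<epsilon> b
      then Inf {chain_length \<gamma> | \<gamma> \<alpha> \<beta>. \<alpha> \<in> A \<and> \<beta> \<in> B \<and> \<gamma> \<in> eps_class X \<epsilon> (rev \<alpha> @ tl \<beta>)}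
      else 0)"

abbreviation eps_topology :: "'a::metric_space set \<Rightarrow> real \<Rightarrow> 'a \<Rightarrow> 'a list set topology" where
  "eps_topology X \<epsilon> b \<equiv> Metric_space.mtopology (eps_cover X \<epsilon> b) (eps_dist X \<epsilon> b)"

text \<open>All chains in a class have the same last point.\<close>

definition eps_endpoint :: "'a::metric_space list set \<Rightarrow> 'a" where
  "eps_endpoint A = the_elem (last ` A)"


text \<open>
  The function \<open>eps_dist\<close> is a metric on the set of classes, so that \<open>eps_topology\<close> is the
  topology of a metric space.
\<close>

lemma chain_length_single [simp]: "chain_length [x] = 0"
  by (simp add: chain_length_def)

lemma chain_length_Cons2 [simp]: "chain_length (x # y # zs) = dist x y + chain_length (y # zs)"
  by (simp add: chain_length_def sum.lessThan_Suc_shift del: sum.lessThan_Suc)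

lemma chain_length_nonneg [simp]: "0 \<le> chain_length xs"
  by (simp add: chain_length_def sum_nonneg)

lemma chain_length_append:
  "us \<noteq> [] \<Longrightarrow> chain_length (us @ x # vs) = chain_length us + dist (last us) x + chain_length (x # vs)"
proof (induction us)
  case (Cons a us)
  then show ?case by (cases us) auto
qed simp

lemma chain_length_glue:
  assumes "us \<noteq> []" "vs \<noteq> []" "last us = hd vs"
  shows "chain_length (us @ tl vs) = chain_length us + chain_length vs"
proof (cases vs)
  case (Cons v ws)
  with assms show ?thesis
    by (cases ws) (auto simp: chain_length_append)
qed (use assms in simp)

lemma chain_length_rev [simp]: "chain_length (rev xs) = chain_length xs"
proof (induction xs)
  case (Cons x xs)
  then show ?case
    by (cases xs) (use chain_length_append[of "rev xs" x "[]"] in \<open>auto simp: dist_commute\<close>)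
qed simp

lemma dist_le_chain_length: "xs \<noteq> [] \<Longrightarrow> dist (hd xs) (last xs) \<le> chain_length xs"
proof (induction xs)
  case (Cons x xs)
  show ?case
  proof (cases xs)
    case (Cons y ys)
    with Cons.IH have "dist y (last xs) \<le> chain_length xs" by simp
    then show ?thesis
      using Cons dist_triangle[of x "last xs" y] by simp
  qed simp
qed simp

lemma eps_homotopic_refl [simp]: "eps_homotopic X \<epsilon> xs xs"
  by (simp add: eps_homotopic_def)

lemma eps_homotopic_trans [trans]:
  "eps_homotopic X \<epsilon> xs ys \<Longrightarrow> eps_homotopic X \<epsilon> ys zs \<Longrightarrow> eps_homotopic X \<epsilon> xs zs"
  unfolding eps_homotopic_def by (rule rtranclp_trans)

lemma eps_homotopic_sym: "eps_homotopic X \<epsilon> xs ys \<Longrightarrow> eps_homotopic X \<epsilon> ys xs"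
  unfolding eps_homotopic_def
  by (rule sympD[OF symp_rtranclp]) (auto intro: sympI)

lemma add_point_imp_homotopic: "add_point X \<epsilon> xs ys \<Longrightarrow> eps_homotopic X \<epsilon> xs ys"
  unfolding eps_homotopic_def by auto

lemma eps_homotopicD:
  assumes "eps_homotopic X \<epsilon> xs ys" "eps_chain X \<epsilon> xs"
  shows "eps_chain X \<epsilon> ys \<and> hd ys = hd xs \<and> last ys = last xs"
  using assms unfolding eps_homotopic_def
  by (induction rule: rtranclp_induct) (auto simp: add_point_def)

lemma eps_homotopic_map:
  assumes "eps_homotopic X \<epsilon> xs ys" "eps_chain X \<epsilon> xs"
    and "\<And>us vs. add_point X \<epsilon> us vs \<Longrightarrow> hd us = hd xs \<Longrightarrow> last us = last xs \<Longrightarrow> add_point X \<epsilon> (f us) (f vs)"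
  shows "eps_homotopic X \<epsilon> (f xs) (f ys)"
  using assms(1) unfolding eps_homotopic_def
proof (induction rule: rtranclp_induct)
  case (step y z)
  then have "eps_homotopic X \<epsilon> xs y" by (simp add: eps_homotopic_def)
  then have y: "eps_chain X \<epsilon> y" "hd y = hd xs" "last y = last xs"
    using eps_homotopicD assms(2) by blast+
  have "add_point X \<epsilon> (f y) (f z) \<or> add_point X \<epsilon> (f z) (f y)"
  proof (cases "add_point X \<epsilon> y z")
    case True then show ?thesis using assms(3) y by blast
  next
    case False
    with step have *: "add_point X \<epsilon> z y" by simp
    then have "hd z = hd xs" "last z = last xs" using y by (auto simp: add_point_def)
    then show ?thesis using assms(3) * by blast
  qed
  then show ?case by (intro rtranclp.rtrancl_into_rtrancl[OF step.IH])
qed simp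

lemma eps_chain_glue:
  assumes "eps_chain X \<epsilon> \<alpha>" "eps_chain X \<epsilon> \<beta>" "last \<alpha> = hd \<beta>"
  shows "eps_chain X \<epsilon> (\<alpha> @ tl \<beta>)"
  using assms by (cases \<beta>; cases "tl \<beta>") (auto simp: eps_chain_def successively_append_iff)

lemma last_glue: "\<beta> \<noteq> [] \<Longrightarrow> last \<alpha> = hd \<beta> \<Longrightarrow> last (\<alpha> @ tl \<beta>) = last \<beta>"
  by (cases \<beta>) auto

lemma eps_chain_rev: "eps_chain X \<epsilon> (rev \<alpha>) \<longleftrightarrow> eps_chain X \<epsilon> \<alpha>"
  by (simp add: eps_chain_def dist_commute)

lemma eps_homotopic_rev:
  assumes "eps_homotopic X \<epsilon> \<alpha> \<beta>" "eps_chain X \<epsilon> \<alpha>"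
  shows "eps_homotopic X \<epsilon> (rev \<alpha>) (rev \<beta>)"
proof (rule eps_homotopic_map[OF assms])
  fix us vs assume *: "add_point X \<epsilon> us vs"
  then obtain p x q where "us = p @ q" "vs = p @ x # q" by (auto simp: add_point_def)
  then have "rev us = rev q @ rev p \<and> rev vs = rev q @ x # rev p" by auto
  then have "\<exists>p x q. rev us = p @ q \<and> rev vs = p @ x # q" by blast
  moreover have "eps_chain X \<epsilon> us" "eps_chain X \<epsilon> vs" "us \<noteq> []" "vs \<noteq> []" "hd us = hd vs" "last us = last vs"
    using * by (auto simp: add_point_def eps_chain_def)
  ultimately show "add_point X \<epsilon> (rev us) (rev vs)"
    by (simp add: add_point_def eps_chain_rev hd_rev last_rev)
qed

lemma eps_homotopic_glue1:
  assumes "eps_homotopic X \<epsilon> \<alpha> \<alpha>'" "eps_chain X \<epsilon> \<alpha>" "eps_chain X \<epsilon> \<beta>" "last \<alpha> = hd \<beta>"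
  shows "eps_homotopic X \<epsilon> (\<alpha> @ tl \<beta>) (\<alpha>' @ tl \<beta>)"
proof (rule eps_homotopic_map[OF assms(1,2), where f = "\<lambda>\<alpha>. \<alpha> @ tl \<beta>"])
  fix us vs assume *: "add_point X \<epsilon> us vs" "last us = last \<alpha>"
  then obtain p x q where "us = p @ q" "vs = p @ x # q" by (auto simp: add_point_def)
  then have "us @ tl \<beta> = p @ (q @ tl \<beta>) \<and> vs @ tl \<beta> = p @ x # (q @ tl \<beta>)" by simp
  then have 1: "\<exists>p x q. us @ tl \<beta> = p @ q \<and> vs @ tl \<beta> = p @ x # q" by blast
  have 2: "eps_chain X \<epsilon> us" "eps_chain X \<epsilon> vs" "us \<noteq> []" "vs \<noteq> []" "hd us = hd vs"
    "last us = hd \<beta>" "last vs = hd \<beta>" "\<beta> \<noteq> []"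
    using * assms(3,4) by (auto simp: add_point_def eps_chain_def)
  have 3: "eps_chain X \<epsilon> (us @ tl \<beta>)" "eps_chain X \<epsilon> (vs @ tl \<beta>)"
    by (rule eps_chain_glue[OF 2(1) assms(3) 2(6)], rule eps_chain_glue[OF 2(2) assms(3) 2(7)])
  have 4: "hd (us @ tl \<beta>) = hd (vs @ tl \<beta>)" using 2(3-5) by simp
  have 5: "last (us @ tl \<beta>) = last (vs @ tl \<beta>)" 
    using last_glue[OF 2(8,6)] last_glue[OF 2(8,7)] by (simp only:)
  show "add_point X \<epsilon> (us @ tl \<beta>) (vs @ tl \<beta>)"
    unfolding add_point_def using 1 3 4 5 by blast
qed

lemma eps_homotopic_glue2:
  assumes "eps_homotopic X \<epsilon> \<beta> \<beta>'" "eps_chain X \<epsilon> \<alpha>" "eps_chain X \<epsilon> \<beta>" "last \<alpha> = hd \<beta>"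
  shows "eps_homotopic X \<epsilon> (\<alpha> @ tl \<beta>) (\<alpha> @ tl \<beta>')"
proof (rule eps_homotopic_map[OF assms(1,3), where f = "\<lambda>\<beta>. \<alpha> @ tl \<beta>"])
  fix us vs assume *: "add_point X \<epsilon> us vs" "hd us = hd \<beta>"
  then obtain p x q where pq: "us = p @ q" "vs = p @ x # q" by (auto simp: add_point_def)
  have 2: "eps_chain X \<epsilon> us" "eps_chain X \<epsilon> vs" "us \<noteq> []" "vs \<noteq> []" "last us = last vs"
    "last \<alpha> = hd us" "last \<alpha> = hd vs" "\<alpha> \<noteq> []"
    using * assms(2,4) by (auto simp: add_point_def eps_chain_def)
  have 1: "\<exists>p x q. \<alpha> @ tl us = p @ q \<and> \<alpha> @ tl vs = p @ x # q"
  proof (cases p)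
    case Nil
    then have "tl vs = us" using pq by simp
    also have "us = hd us # tl us" using \<open>us \<noteq> []\<close> by simp
    finally have "\<alpha> @ tl vs = \<alpha> @ hd us # tl us" by simp
    then show ?thesis by blast
  next
    case (Cons a p')
    then have "\<alpha> @ tl us = (\<alpha> @ p') @ q \<and> \<alpha> @ tl vs = (\<alpha> @ p') @ x # q" using pq by simp
    then show ?thesis by blast
  qed
  have 3: "eps_chain X \<epsilon> (\<alpha> @ tl us)" "eps_chain X \<epsilon> (\<alpha> @ tl vs)"
    by (rule eps_chain_glue[OF assms(2) 2(1,6)], rule eps_chain_glue[OF assms(2) 2(2,7)])
  have 4: "hd (\<alpha> @ tl us) = hd (\<alpha> @ tl vs)" using 2(8) by simp
  have 5: "last (\<alpha> @ tl us) = last (\<alpha> @ tl vs)"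
    using last_glue[OF 2(3,6)] last_glue[OF 2(4,7)] 2(5) by (simp only:)
  show "add_point X \<epsilon> (\<alpha> @ tl us) (\<alpha> @ tl vs)"
    unfolding add_point_def using 1 3 4 5 by blast
qed

lemma eps_homotopic_remove:
  assumes "eps_chain X \<epsilon> (us @ x # vs)" "eps_chain X \<epsilon> (us @ vs)"
    "hd (us @ vs) = hd (us @ x # vs)" "last (us @ vs) = last (us @ x # vs)"
  shows "eps_homotopic X \<epsilon> (us @ x # vs) (us @ vs)"
proof -
  have "add_point X \<epsilon> (us @ vs) (us @ x # vs)"
    unfolding add_point_def
    by (intro conjI exI[of _ us] exI[of _ x] exI[of _ vs] refl) (rule assms)+
  then show ?thesis by (rule eps_homotopic_sym[OF add_point_imp_homotopic])
qed

lemma eps_homotopic_short_loop: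
  assumes "\<epsilon> > 0" "eps_chain X \<epsilon> (x # ys @ [x])" "chain_length (x # ys @ [x]) < \<epsilon>"
  shows "eps_homotopic X \<epsilon> (x # ys @ [x]) [x]"
  using assms(2,3)
proof (induction ys)
  case Nil
  then show ?case
    using eps_homotopic_remove[of X \<epsilon> "[x]" x "[]"] by (auto simp: eps_chain_def)
next
  case (Cons y ys)
  define z zs where "z = hd (ys @ [x])" and "zs = tl (ys @ [x])"
  have z: "ys @ [x] = z # zs" by (simp add: z_def zs_def)
  have c: "dist x y + (dist y z + chain_length (z # zs)) < \<epsilon>" using Cons.prems(2) z by simp
  have t: "dist x z \<le> dist x y + dist y z" by (rule dist_triangle)
  have "0 \<le> chain_length (z # zs)" by simp
  with c t have d: "dist x z < \<epsilon>" by linarith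
  have ch: "eps_chain X \<epsilon> (x # ys @ [x])"
    using Cons.prems(1) d z by (auto simp: eps_chain_def)
  have len: "chain_length (x # ys @ [x]) < \<epsilon>" using c t z by simp
  have "eps_homotopic X \<epsilon> ([x] @ y # (ys @ [x])) ([x] @ (ys @ [x]))"
    by (rule eps_homotopic_remove) (use Cons.prems ch in auto)
  then show ?case using Cons.IH[OF ch len] by (auto intro: eps_homotopic_trans)
qed

lemma eps_homotopic_rinv:
  assumes "\<epsilon> > 0" "eps_chain X \<epsilon> \<alpha>"
  shows "eps_homotopic X \<epsilon> (\<alpha> @ tl (rev \<alpha>)) [hd \<alpha>]"
  using assms(2)
proof (induction \<alpha>)
  case Nil then show ?case by (simp add: eps_chain_def)
next
  case (Cons x \<alpha>)
  show ?case
  proof (cases \<alpha>)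
    case (Cons y \<beta>)
    have xy: "x \<in> X" "y \<in> X" "dist x y < \<epsilon>" and ch: "eps_chain X \<epsilon> \<alpha>"
      using Cons.prems Cons by (auto simp: eps_chain_def)
    have ch2: "eps_chain X \<epsilon> (\<alpha> @ tl (rev \<alpha>))" 
      by (rule eps_chain_glue) (use ch in \<open>auto simp: eps_chain_rev hd_rev\<close>)
    have h: "hd (\<alpha> @ tl (rev \<alpha>)) = y" "last (\<alpha> @ tl (rev \<alpha>)) = y"
      using Cons last_glue[of "rev \<alpha>" \<alpha>] by (auto simp: hd_rev last_rev)
    have c: "eps_chain X \<epsilon> [x, y]" "eps_chain X \<epsilon> [y, x]" "eps_chain X \<epsilon> [x]" "eps_chain X \<epsilon> [x, x]"
      "eps_chain X \<epsilon> [x, y, x]"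
      using xy assms(1) by (auto simp: eps_chain_def dist_commute)
    have ne: "tl (rev \<alpha> @ [x]) = tl (rev \<alpha>) @ [x]" using Cons by (intro tl_append2) auto
    have "eps_homotopic X \<epsilon> ([x, y] @ tl (\<alpha> @ tl (rev \<alpha>))) ([x, y] @ tl [hd \<alpha>])"
      by (rule eps_homotopic_glue2[OF Cons.IH[OF ch] c(1) ch2]) (use h in simp)
    moreover have "eps_chain X \<epsilon> ([x, y] @ tl (\<alpha> @ tl (rev \<alpha>)))"
      by (rule eps_chain_glue[OF c(1) ch2]) (use h in simp)
    ultimately have "eps_homotopic X \<epsilon> (([x, y] @ tl (\<alpha> @ tl (rev \<alpha>))) @ tl [y, x]) (([x, y] @ tl [hd \<alpha>]) @ tl [y, x])"
      using eps_homotopic_glue1[OF _ _ c(2)] h last_glue[of "\<alpha> @ tl (rev \<alpha>)" "[x, y]"] Cons by fastforce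
    moreover have "([x, y] @ tl (\<alpha> @ tl (rev \<alpha>))) @ tl [y, x] = (x # \<alpha>) @ tl (rev (x # \<alpha>))"
      using Cons ne by simp
    moreover have "eps_homotopic X \<epsilon> [x, y, x] [x, x]"
      using eps_homotopic_remove[of X \<epsilon> "[x]" y "[x]"] c by simp
    moreover have "eps_homotopic X \<epsilon> [x, x] [x]"
      using eps_homotopic_remove[of X \<epsilon> "[x]" x "[]"] c by simp
    ultimately show ?thesis using eps_homotopic_trans by (metis append_Cons append_Nil list.sel(1,3))
  qed simp
qed

lemma eps_class_eq_iff: "eps_class X \<epsilon> \<alpha> = eps_class X \<epsilon> \<beta> \<longleftrightarrow> eps_homotopic X \<epsilon> \<alpha> \<beta>"
  unfolding eps_class_def
  by (blast intro: eps_homotopic_refl eps_homotopic_sym eps_homotopic_trans)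

lemma eps_homotopic_diff:
  assumes "eps_homotopic X \<epsilon> \<alpha> \<alpha>'" "eps_homotopic X \<epsilon> \<beta> \<beta>'"
    "eps_chain X \<epsilon> \<alpha>" "eps_chain X \<epsilon> \<beta>" "hd \<alpha> = hd \<beta>"
  shows "eps_homotopic X \<epsilon> (rev \<alpha> @ tl \<beta>) (rev \<alpha>' @ tl \<beta>')"
proof (rule eps_homotopic_trans)
  have \<alpha>': "eps_chain X \<epsilon> \<alpha>'" "hd \<alpha>' = hd \<alpha>" using eps_homotopicD assms by blast+
  show "eps_homotopic X \<epsilon> (rev \<alpha> @ tl \<beta>) (rev \<alpha>' @ tl \<beta>)"
    by (rule eps_homotopic_glue1[OF eps_homotopic_rev[OF assms(1,3)]])
      (use assms in \<open>auto simp: eps_chain_rev last_rev\<close>)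
  show "eps_homotopic X \<epsilon> (rev \<alpha>' @ tl \<beta>) (rev \<alpha>' @ tl \<beta>')"
    by (rule eps_homotopic_glue2[OF assms(2)])
      (use assms \<alpha>' in \<open>auto simp: eps_chain_rev last_rev\<close>)
qed

lemma eps_dist_class:
  assumes "eps_chain X \<epsilon> \<alpha>" "hd \<alpha> = b" "eps_chain X \<epsilon> \<beta>" "hd \<beta> = b"
  shows "eps_dist X \<epsilon> b (eps_class X \<epsilon> \<alpha>) (eps_class X \<epsilon> \<beta>) =
    Inf (chain_length ` eps_class X \<epsilon> (rev \<alpha> @ tl \<beta>))"
proof -
  have "eps_class X \<epsilon> (rev \<alpha>' @ tl \<beta>') = eps_class X \<epsilon> (rev \<alpha> @ tl \<beta>)"
    if "\<alpha>' \<in> eps_class X \<epsilon> \<alpha>" "\<beta>' \<in> eps_class X \<epsilon> \<beta>" for \<alpha>' \<beta>'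
    unfolding eps_class_eq_iff 
    by (rule eps_homotopic_sym, rule eps_homotopic_diff) (use that assms in \<open>auto simp: eps_class_def\<close>)
  then have "{chain_length \<gamma> | \<gamma> \<alpha>' \<beta>'. \<alpha>' \<in> eps_class X \<epsilon> \<alpha> \<and> \<beta>' \<in> eps_class X \<epsilon> \<beta> \<and>
      \<gamma> \<in> eps_class X \<epsilon> (rev \<alpha>' @ tl \<beta>')} = chain_length ` eps_class X \<epsilon> (rev \<alpha> @ tl \<beta>)"
    by (auto simp: image_iff) (metis eps_class_def eps_homotopic_refl mem_Collect_eq)+
  moreover have "eps_class X \<epsilon> \<alpha> \<in> eps_cover X \<epsilon> b" "eps_class X \<epsilon> \<beta> \<in> eps_cover X \<epsilon> b"
    using assms by (auto simp: eps_cover_def)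
  ultimately show ?thesis by (simp add: eps_dist_def)
qed

lemma bdd_below_chain_length: "bdd_below (chain_length ` S)"
  by (rule bdd_belowI[of _ 0]) auto

lemma eps_dist_nonneg: "0 \<le> eps_dist X \<epsilon> b A B"
proof (cases "A \<in> eps_cover X \<epsilon> b \<and> B \<in> eps_cover X \<epsilon> b")
  case True
  then obtain \<alpha> \<beta> where "eps_chain X \<epsilon> \<alpha>" "hd \<alpha> = b" "eps_chain X \<epsilon> \<beta>" "hd \<beta> = b"
    "A = eps_class X \<epsilon> \<alpha>" "B = eps_class X \<epsilon> \<beta>" by (auto simp: eps_cover_def)
  moreover have "eps_class X \<epsilon> (rev \<alpha> @ tl \<beta>) \<noteq> {}" by (auto simp: eps_class_def intro: eps_homotopic_refl)
  ultimately show ?thesis by (auto simp: eps_dist_class intro!: cINF_greatest)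
qed (auto simp: eps_dist_def)

lemma eps_dist_le_commute:
  "eps_dist X \<epsilon> b A B \<le> eps_dist X \<epsilon> b B A"
proof (cases "A \<in> eps_cover X \<epsilon> b \<and> B \<in> eps_cover X \<epsilon> b")
  case True
  then obtain \<alpha> \<beta> where *: "eps_chain X \<epsilon> \<alpha>" "hd \<alpha> = b" "eps_chain X \<epsilon> \<beta>" "hd \<beta> = b"
    "A = eps_class X \<epsilon> \<alpha>" "B = eps_class X \<epsilon> \<beta>" by (auto simp: eps_cover_def)
  have r: "rev (rev \<beta> @ tl \<alpha>) = rev \<alpha> @ tl \<beta>"
    using * by (cases \<alpha>; cases \<beta>) (auto simp: eps_chain_def)
  have ch: "eps_chain X \<epsilon> (rev \<beta> @ tl \<alpha>)"
    by (rule eps_chain_glue) (use * in \<open>auto simp: eps_chain_rev last_rev\<close>)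
  have "\<exists>\<gamma>'\<in>eps_class X \<epsilon> (rev \<alpha> @ tl \<beta>). chain_length \<gamma>' \<le> chain_length \<gamma>"
    if "\<gamma> \<in> eps_class X \<epsilon> (rev \<beta> @ tl \<alpha>)" for \<gamma>
    using that eps_homotopic_rev[OF _ ch] r by (intro bexI[of _ "rev \<gamma>"]) (auto simp: eps_class_def)
  moreover have "eps_class X \<epsilon> (rev \<beta> @ tl \<alpha>) \<noteq> {}" by (auto simp: eps_class_def intro: eps_homotopic_refl)
  ultimately show ?thesis 
    using * by (auto simp: eps_dist_class intro!: cINF_mono bdd_below_chain_length)
qed (auto simp: eps_dist_def)

lemma Metric_space_eps_cover:
  assumes "\<epsilon> > 0"
  shows "Metric_space (eps_cover X \<epsilon> b) (eps_dist X \<epsilon> b)"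
proof
  fix A B C
  show "0 \<le> eps_dist X \<epsilon> b A B" by (rule eps_dist_nonneg)
  show "eps_dist X \<epsilon> b A B = eps_dist X \<epsilon> b B A" by (intro antisym eps_dist_le_commute)
  assume AB: "A \<in> eps_cover X \<epsilon> b" "B \<in> eps_cover X \<epsilon> b"
  then obtain \<alpha> \<beta> where *: "eps_chain X \<epsilon> \<alpha>" "hd \<alpha> = b" "eps_chain X \<epsilon> \<beta>" "hd \<beta> = b"
    "A = eps_class X \<epsilon> \<alpha>" "B = eps_class X \<epsilon> \<beta>" by (auto simp: eps_cover_def)
  have ab: "\<alpha> \<noteq> []" "\<beta> \<noteq> []" using * by (auto simp: eps_chain_def)
  have ne: "eps_class X \<epsilon> xs \<noteq> {}" for xs by (auto simp: eps_class_def intro: eps_homotopic_refl)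
  have ch: "eps_chain X \<epsilon> (rev \<alpha> @ tl \<beta>)"
    by (rule eps_chain_glue) (use * in \<open>auto simp: eps_chain_rev last_rev\<close>)
  have ends: "hd (rev \<alpha> @ tl \<beta>) = last \<alpha>" "last (rev \<alpha> @ tl \<beta>) = last \<beta>"
    using ab * last_glue[of \<beta> "rev \<alpha>"] by (auto simp: hd_rev last_rev)
  have rinv: "eps_homotopic X \<epsilon> (\<alpha> @ tl (rev \<alpha>)) [b]" 
    using eps_homotopic_rinv[OF assms *(1)] * by simp
  have ch\<alpha>: "eps_chain X \<epsilon> (\<alpha> @ tl (rev \<alpha>))" 
    by (rule eps_chain_glue) (use * ab in \<open>auto simp: eps_chain_rev hd_rev\<close>)
  show "eps_dist X \<epsilon> b A B = 0 \<longleftrightarrow> A = B"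
  proof
    assume "A = B"
    moreover have "eps_homotopic X \<epsilon> (rev \<alpha> @ tl \<alpha>) [last \<alpha>]"
      using eps_homotopic_rinv[OF assms, of X "rev \<alpha>"] * ab by (simp add: eps_chain_rev hd_rev)
    then have "Inf (chain_length ` eps_class X \<epsilon> (rev \<alpha> @ tl \<alpha>)) \<le> chain_length [last \<alpha>]"
      by (intro cINF_lower bdd_below_chain_length) (simp add: eps_class_def)
    moreover have "eps_dist X \<epsilon> b A A = Inf (chain_length ` eps_class X \<epsilon> (rev \<alpha> @ tl \<alpha>))"
      using * eps_dist_class by metis
    ultimately show "eps_dist X \<epsilon> b A B = 0"
      using eps_dist_nonneg[of X \<epsilon> b A B] by simp
  next
    assume 0: "eps_dist X \<epsilon> b A B = 0"
    have ex: "\<exists>\<gamma>. eps_homotopic X \<epsilon> (rev \<alpha> @ tl \<beta>) \<gamma> \<and> chain_length \<gamma> < e" if "e > 0" for e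
    proof -
      have "Inf (chain_length ` eps_class X \<epsilon> (rev \<alpha> @ tl \<beta>)) < e"
        using 0 that * eps_dist_class by metis
      then show ?thesis
        using ne by (subst (asm) cINF_less_iff) (auto simp: bdd_below_chain_length eps_class_def)
    qed
    have "dist (last \<alpha>) (last \<beta>) \<le> 0"
    proof (rule field_le_epsilon)
      fix e :: real assume "e > 0"
      then obtain \<gamma> where "eps_homotopic X \<epsilon> (rev \<alpha> @ tl \<beta>) \<gamma>" "chain_length \<gamma> < e" using ex by blast
      then show "dist (last \<alpha>) (last \<beta>) \<le> 0 + e"
        using eps_homotopicD[OF _ ch, of \<gamma>] dist_le_chain_length[of \<gamma>] ends by (auto simp: eps_chain_def)
    qed
    then have eq: "last \<alpha> = last \<beta>" by simp
    define x where "x = last \<alpha>"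
    obtain \<gamma> where \<gamma>: "eps_homotopic X \<epsilon> (rev \<alpha> @ tl \<beta>) \<gamma>" "chain_length \<gamma> < \<epsilon>" using ex assms by blast
    then have g: "eps_chain X \<epsilon> \<gamma>" "hd \<gamma> = x" "last \<gamma> = x"
      using eps_homotopicD[OF _ ch, of \<gamma>] ends eq by (auto simp: x_def)
    have "eps_homotopic X \<epsilon> \<gamma> [x]"
    proof (cases "\<gamma> = [x]")
      case False
      with g have "\<gamma> = x # butlast (tl \<gamma>) @ [x]"
        by (metis append_butlast_last_id eps_chain_def last_tl list.collapse)
      then show ?thesis using eps_homotopic_short_loop[OF assms] g(1) \<gamma>(2) by metis
    qed simp
    with \<gamma>(1) have null: "eps_homotopic X \<epsilon> (rev \<alpha> @ tl \<beta>) [x]" by (rule eps_homotopic_trans)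
    have "eps_homotopic X \<epsilon> (\<alpha> @ tl (rev \<alpha> @ tl \<beta>)) (\<alpha> @ tl [x])"
      by (rule eps_homotopic_glue2[OF null]) (use * ch ends in auto)
    moreover have "eps_homotopic X \<epsilon> ((\<alpha> @ tl (rev \<alpha>)) @ tl \<beta>) ([b] @ tl \<beta>)"
      by (rule eps_homotopic_glue1[OF rinv ch\<alpha> *(3)])
        (use * ab last_glue[of "rev \<alpha>" \<alpha>] in \<open>auto simp: hd_rev last_rev\<close>)
    moreover have "(\<alpha> @ tl (rev \<alpha>)) @ tl \<beta> = \<alpha> @ tl (rev \<alpha> @ tl \<beta>)"
      using ab(1) by simp
    moreover have "[b] @ tl \<beta> = \<beta>" using ab(2) *(4) by (cases \<beta>) auto
    moreover have "\<alpha> @ tl [x] = \<alpha>" by simp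
    ultimately have "eps_homotopic X \<epsilon> (\<alpha> @ tl (rev \<alpha> @ tl \<beta>)) \<alpha>"
      "eps_homotopic X \<epsilon> (\<alpha> @ tl (rev \<alpha> @ tl \<beta>)) \<beta>" by simp_all
    then have "eps_homotopic X \<epsilon> \<alpha> \<beta>" using eps_homotopic_sym eps_homotopic_trans by blast
    then show "A = B" using * by (simp add: eps_class_eq_iff)
  qed
  assume "C \<in> eps_cover X \<epsilon> b"
  then obtain \<kappa> where k: "eps_chain X \<epsilon> \<kappa>" "hd \<kappa> = b" "C = eps_class X \<epsilon> \<kappa>"
    by (auto simp: eps_cover_def)
  have kne: "\<kappa> \<noteq> []" using k by (auto simp: eps_chain_def)
  have ch2: "eps_chain X \<epsilon> (rev \<beta> @ tl \<kappa>)"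
    by (rule eps_chain_glue) (use * k in \<open>auto simp: eps_chain_rev last_rev\<close>)
  have ends2: "hd (rev \<beta> @ tl \<kappa>) = last \<beta>" using ab by (auto simp: hd_rev)
  have main: "eps_homotopic X \<epsilon> ((rev \<alpha> @ tl \<beta>) @ tl (rev \<beta> @ tl \<kappa>)) (rev \<alpha> @ tl \<kappa>)"
  proof -
    have rb: "eps_chain X \<epsilon> (\<beta> @ tl (rev \<beta>))" "last (\<beta> @ tl (rev \<beta>)) = b" "hd (\<beta> @ tl (rev \<beta>)) = b"
      using eps_chain_glue[of X \<epsilon> \<beta> "rev \<beta>"] last_glue[of "rev \<beta>" \<beta>] * ab
      by (auto simp: eps_chain_rev hd_rev last_rev)
    have "eps_homotopic X \<epsilon> ((\<beta> @ tl (rev \<beta>)) @ tl \<kappa>) ([b] @ tl \<kappa>)"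
      by (rule eps_homotopic_glue1[OF _ rb(1) k(1)])
        (use eps_homotopic_rinv[OF assms *(3)] * k rb in auto)
    moreover have "[b] @ tl \<kappa> = \<kappa>" using k(2) kne by (cases \<kappa>) auto
    ultimately have h: "eps_homotopic X \<epsilon> ((\<beta> @ tl (rev \<beta>)) @ tl \<kappa>) \<kappa>" by simp
    have "eps_homotopic X \<epsilon> (rev \<alpha> @ tl ((\<beta> @ tl (rev \<beta>)) @ tl \<kappa>)) (rev \<alpha> @ tl \<kappa>)"
      by (rule eps_homotopic_glue2[OF h])
        (use * ab rb k eps_chain_glue[OF rb(1) k(1)] in \<open>auto simp: eps_chain_rev last_rev\<close>)
    then show ?thesis using ab by simp
  qed
  have bound: "eps_dist X \<epsilon> b A C \<le> chain_length \<gamma> + chain_length \<gamma>'"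
    if "eps_homotopic X \<epsilon> (rev \<alpha> @ tl \<beta>) \<gamma>" "eps_homotopic X \<epsilon> (rev \<beta> @ tl \<kappa>) \<gamma>'" for \<gamma> \<gamma>'
  proof -
    have g: "eps_chain X \<epsilon> \<gamma>" "last \<gamma> = last \<beta>" "eps_chain X \<epsilon> \<gamma>'" "hd \<gamma>' = last \<beta>"
      using eps_homotopicD[OF that(1) ch] eps_homotopicD[OF that(2) ch2] ends ends2 by auto
    have "eps_homotopic X \<epsilon> ((rev \<alpha> @ tl \<beta>) @ tl (rev \<beta> @ tl \<kappa>)) (\<gamma> @ tl (rev \<beta> @ tl \<kappa>))"
      by (rule eps_homotopic_glue1[OF that(1) ch ch2]) (use ends ends2 in auto)
    moreover have "eps_homotopic X \<epsilon> (\<gamma> @ tl (rev \<beta> @ tl \<kappa>)) (\<gamma> @ tl \<gamma>')"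
      by (rule eps_homotopic_glue2[OF that(2) g(1) ch2]) (use g ends2 in auto)
    ultimately have "eps_homotopic X \<epsilon> (rev \<alpha> @ tl \<kappa>) (\<gamma> @ tl \<gamma>')"
      using main eps_homotopic_sym eps_homotopic_trans by metis
    then have "Inf (chain_length ` eps_class X \<epsilon> (rev \<alpha> @ tl \<kappa>)) \<le> chain_length (\<gamma> @ tl \<gamma>')"
      by (intro cINF_lower bdd_below_chain_length) (simp add: eps_class_def)
    moreover have "chain_length (\<gamma> @ tl \<gamma>') = chain_length \<gamma> + chain_length \<gamma>'"
      by (rule chain_length_glue) (use g in \<open>auto simp: eps_chain_def\<close>)
    moreover have "eps_dist X \<epsilon> b A C = Inf (chain_length ` eps_class X \<epsilon> (rev \<alpha> @ tl \<kappa>))"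
      using * k eps_dist_class by metis
    ultimately show ?thesis by simp
  qed
  have AB_eq: "eps_dist X \<epsilon> b A B = Inf (chain_length ` eps_class X \<epsilon> (rev \<alpha> @ tl \<beta>))"
    and BC_eq: "eps_dist X \<epsilon> b B C = Inf (chain_length ` eps_class X \<epsilon> (rev \<beta> @ tl \<kappa>))"
    using * k eps_dist_class by metis+
  have "eps_dist X \<epsilon> b A C - eps_dist X \<epsilon> b B C \<le> eps_dist X \<epsilon> b A B"
    unfolding AB_eq
  proof (rule cINF_greatest[OF ne])
    fix \<gamma> assume \<gamma>: "\<gamma> \<in> eps_class X \<epsilon> (rev \<alpha> @ tl \<beta>)"
    have "eps_dist X \<epsilon> b A C - chain_length \<gamma> \<le> eps_dist X \<epsilon> b B C"
      unfolding BC_eq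
    proof (rule cINF_greatest[OF ne])
      fix \<gamma>' assume "\<gamma>' \<in> eps_class X \<epsilon> (rev \<beta> @ tl \<kappa>)"
      then show "eps_dist X \<epsilon> b A C - chain_length \<gamma> \<le> chain_length \<gamma>'"
        using bound[of \<gamma> \<gamma>'] \<gamma> by (simp add: eps_class_def)
    qed
    then show "eps_dist X \<epsilon> b A C - eps_dist X \<epsilon> b B C \<le> chain_length \<gamma>" by simp
  qed
  then show "eps_dist X \<epsilon> b A C \<le> eps_dist X \<epsilon> b A B + eps_dist X \<epsilon> b B C" by simp
qed

lemma eps_endpoint_class [simp]:
  assumes "eps_chain X \<epsilon> \<alpha>"
  shows "eps_endpoint (eps_class X \<epsilon> \<alpha>) = last \<alpha>"
proof -
  have "last \<beta> = last \<alpha>" if "\<beta> \<in> eps_class X \<epsilon> \<alpha>" for \<beta>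
    using that eps_homotopicD[OF _ assms, of \<beta>] by (simp add: eps_class_def)
  moreover have "\<alpha> \<in> eps_class X \<epsilon> \<alpha>" by (simp add: eps_class_def)
  ultimately have "last ` eps_class X \<epsilon> \<alpha> = {last \<alpha>}" by blast
  then show ?thesis by (simp add: eps_endpoint_def)
qed


section \<open>The fundamental group and the cover determined by small loops\<close>

definition loops :: "'a::topological_space set \<Rightarrow> 'a \<Rightarrow> (real \<Rightarrow> 'a) set" where
  "loops X b = {g. path g \<and> path_image g \<subseteq> X \<and> pathstart g = b \<and> pathfinish g = b}"

definition loop_class :: "'a::topological_space set \<Rightarrow> (real \<Rightarrow> 'a) \<Rightarrow> (real \<Rightarrow> 'a) set" where
  "loop_class X g = {h. homotopic_paths X g h}"

definition fundamental_group ::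
    "'a::topological_space set \<Rightarrow> 'a \<Rightarrow> (real \<Rightarrow> 'a) set monoid" where
  "fundamental_group X b =
     \<lparr>carrier = loop_class X ` loops X b,
      monoid.mult = (\<lambda>A B. \<Union>f\<in>A. \<Union>g\<in>B. loop_class X (f +++ g)),
      one = loop_class X (\<lambda>_. b)\<rparr>"

text \<open>The inverses taken by \<open>generate\<close> below are those of a group.\<close>

lemma loop_class_eq_iff:
  assumes "f \<in> loops X b"
  shows "loop_class X f = loop_class X g \<longleftrightarrow> homotopic_paths X f g"
proof
  assume "loop_class X f = loop_class X g"
  moreover have "f \<in> loop_class X f" using assms by (simp add: loop_class_def loops_def)
  ultimately have "homotopic_paths X g f" by (simp add: loop_class_def)
  then show "homotopic_paths X f g" by (rule homotopic_paths_sym)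
next
  assume fg: "homotopic_paths X f g"
  have "homotopic_paths X f h \<longleftrightarrow> homotopic_paths X g h" for h
    using homotopic_paths_trans[OF fg] homotopic_paths_trans[OF homotopic_paths_sym[OF fg]] by blast
  then show "loop_class X f = loop_class X g" by (simp add: loop_class_def)
qed

lemma const_loop: "b \<in> X \<Longrightarrow> (\<lambda>_. b) \<in> loops X b"
  by (auto simp: loops_def path_def pathstart_def pathfinish_def path_image_def)

lemma mult_fundamental_group:
  assumes "f \<in> loops X b" "g \<in> loops X b"
  shows "loop_class X f \<otimes>\<^bsub>fundamental_group X b\<^esub> loop_class X g = loop_class X (f +++ g)"
proof -
  have fin: "pathfinish f = pathstart g" using assms by (simp add: loops_def)
  have fg: "f +++ g \<in> loops X b"
    using assms by (auto simp: loops_def subset_path_image_join)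
  have "loop_class X (f' +++ g') = loop_class X (f +++ g)"
    if "f' \<in> loop_class X f" "g' \<in> loop_class X g" for f' g'
  proof -
    have "homotopic_paths X (f +++ g) (f' +++ g')"
      using that fin by (simp add: loop_class_def homotopic_paths_join)
    then show ?thesis unfolding loop_class_eq_iff[OF fg, symmetric] by (rule sym)
  qed
  moreover have "f \<in> loop_class X f" "g \<in> loop_class X g"
    using assms by (simp_all add: loop_class_def loops_def)
  ultimately have "(\<Union>f'\<in>loop_class X f. \<Union>g'\<in>loop_class X g. loop_class X (f' +++ g')) = loop_class X (f +++ g)"
    by blast
  then show ?thesis by (simp add: fundamental_group_def)
qed

lemma homotopic_paths_const_left:
  assumes "path p" "path_image p \<subseteq> S"
  shows "homotopic_paths S ((\<lambda>_. pathstart p) +++ p) p"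
proof (rule homotopic_paths_sym, rule homotopic_paths_reparametrize[OF assms])
  show "continuous_on {0..1} (\<lambda>t::real. max 0 (2 * t - 1))" by (intro continuous_intros)
qed (auto simp: joinpaths_def pathstart_def)

lemma homotopic_paths_inv_left:
  assumes "path p" "path_image p \<subseteq> S"
  shows "homotopic_paths S (reversepath p +++ p) (\<lambda>_. pathfinish p)"
  unfolding homotopic_paths
proof (intro exI conjI ballI)
  let ?s = "\<lambda>y::real \<times> real. max (fst y) \<bar>2 * snd y - 1\<bar>"
  have cp: "continuous_on {0..1} p" using assms by (simp add: path_def)
  show "continuous_on ({0..1} \<times> {0..1}) (\<lambda>y. p (?s y))"
    by (rule continuous_on_compose2[OF cp]) (auto intro!: continuous_intros)
  show "(\<lambda>y. p (?s y)) \<in> {0..1} \<times> {0..1} \<rightarrow> S"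
    using assms by (auto simp: path_image_def max_def abs_if split: if_splits)
  fix t :: real assume t: "t \<in> {0..1}"
  show "p (?s (0, t)) = (reversepath p +++ p) t"
  proof (cases "t \<le> 1/2")
    case True
    then have "?s (0, t) = 1 - 2 * t" by simp
    then show ?thesis using True by (simp add: joinpaths_def reversepath_def)
  next
    case False
    then have "?s (0, t) = 2 * t - 1" by simp
    then show ?thesis using False by (simp add: joinpaths_def)
  qed
  show "p (?s (1, t)) = pathfinish p"
  proof -
    have "?s (1, t) = 1" using t by auto
    then show ?thesis by (simp only: pathfinish_def)
  qed
qed (auto simp: joinpaths_def reversepath_def pathfinish_def pathstart_def)

lemma group_fundamental_group:
  assumes "b \<in> X"
  shows "group (fundamental_group X b)"
proof (rule groupI)
  let ?G = "fundamental_group X b"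
  have carr: "carrier ?G = loop_class X ` loops X b" and one: "\<one>\<^bsub>?G\<^esub> = loop_class X (\<lambda>_. b)"
    by (auto simp: fundamental_group_def)
  have join: "f +++ g \<in> loops X b" if "f \<in> loops X b" "g \<in> loops X b" for f g
    using that by (auto simp: loops_def subset_path_image_join)
  show "\<one>\<^bsub>?G\<^esub> \<in> carrier ?G" using const_loop[OF assms] by (simp add: carr one)
  fix x assume "x \<in> carrier ?G"
  then obtain f where f: "f \<in> loops X b" "x = loop_class X f" by (auto simp: carr)
  show "\<one>\<^bsub>?G\<^esub> \<otimes>\<^bsub>?G\<^esub> x = x"
    using homotopic_paths_const_left[of f X] f const_loop[OF assms] join[of "\<lambda>_. b" f]
    by (simp add: one mult_fundamental_group loop_class_eq_iff) (auto simp: loops_def)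
  have r: "reversepath f \<in> loops X b" using f by (auto simp: loops_def)
  show "\<exists>y\<in>carrier ?G. y \<otimes>\<^bsub>?G\<^esub> x = \<one>\<^bsub>?G\<^esub>"
  proof
    show "loop_class X (reversepath f) \<in> carrier ?G" using r by (simp add: carr)
    show "loop_class X (reversepath f) \<otimes>\<^bsub>?G\<^esub> x = \<one>\<^bsub>?G\<^esub>"
      using homotopic_paths_inv_left[of f X] f r join[of "reversepath f" f]
      by (simp add: one mult_fundamental_group loop_class_eq_iff) (auto simp: loops_def)
  qed
  fix y assume "y \<in> carrier ?G"
  then obtain g where g: "g \<in> loops X b" "y = loop_class X g" by (auto simp: carr)
  show "x \<otimes>\<^bsub>?G\<^esub> y \<in> carrier ?G" using f g join by (auto simp: carr mult_fundamental_group)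
  fix z assume "z \<in> carrier ?G"
  then obtain h where h: "h \<in> loops X b" "z = loop_class X h" by (auto simp: carr)
  have "homotopic_paths X (f +++ g +++ h) ((f +++ g) +++ h)"
    using f g h by (intro homotopic_paths_assoc) (auto simp: loops_def)
  then show "x \<otimes>\<^bsub>?G\<^esub> y \<otimes>\<^bsub>?G\<^esub> z = x \<otimes>\<^bsub>?G\<^esub> (y \<otimes>\<^bsub>?G\<^esub> z)"
    using f g h join by (simp add: mult_fundamental_group) (metis loop_class_eq_iff)
qed

definition small_loop_classes ::
    "'a::metric_space set \<Rightarrow> 'a \<Rightarrow> real \<Rightarrow> (real \<Rightarrow> 'a) set set" where
  "small_loop_classes X b \<delta> =
     {loop_class X (c +++ L +++ reversepath c) | c L.
        path c \<and> path_image c \<subseteq> X \<and> pathstart c = b \<and>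
        L \<in> loops X (pathfinish c) \<and> (\<exists>x\<in>X. path_image L \<subseteq> ball x \<delta>)}"

definition small_loop_subgroup ::
    "'a::metric_space set \<Rightarrow> 'a \<Rightarrow> real \<Rightarrow> (real \<Rightarrow> 'a) set set" where
  "small_loop_subgroup X b \<delta> = generate (fundamental_group X b) (small_loop_classes X b \<delta>)"

text \<open>
  \<open>delta_cover X b \<delta> E p e\<close>: the map \<open>p\<close> from \<open>E\<close>, with base point \<open>e\<close>, is a realization of the
  connected covering map of \<open>X\<close> that is characterized, up to equivalence, by the subgroup
  \<open>small_loop_subgroup X b \<delta>\<close> of the fundamental group.
\<close>

definition delta_cover ::
    "'a::metric_space set \<Rightarrow> 'a \<Rightarrow> real \<Rightarrow> 'e::topological_space set \<Rightarrow> ('e \<Rightarrow> 'a) \<Rightarrow> 'e \<Rightarrow> bool" where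
  "delta_cover X b \<delta> E p e \<longleftrightarrow>
     covering_space E p X \<and> connected E \<and> e \<in> E \<and> p e = b \<and>
     (\<forall>g \<in> loops X b.
        (\<exists>g' \<in> loops E e. \<forall>t\<in>{0..1}. p (g' t) = g t) \<longleftrightarrow>
        loop_class X g \<in> small_loop_subgroup X b \<delta>)"

definition lifted_dist ::
    "'e::topological_space set \<Rightarrow> ('e \<Rightarrow> 'a::metric_space) \<Rightarrow> 'e \<Rightarrow> 'e \<Rightarrow> ennreal" where
  "lifted_dist E p x y =
     (INF c \<in> {c. path c \<and> path_image c \<subseteq> E \<and> pathstart c = x \<and> pathfinish c = y}.
        path_length (p \<circ> c))"

end

theory Submission
  imports Defs
begin

text \<open>
  A loop in a ball of radius \<open>3 * \<epsilon> / 2\<close> about \<open>x\<close> is \<open>\<epsilon>\<close>-null: subdivide the geodesics from \<open>x\<close> to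
  its points at one third of their length and collapse the resulting cone.  Sampling a loop finely
  thus kills the subgroup generated by small loops.  Conversely, loops in such balls lift to closed
  loops of the cover \<open>E\<close>, so a point of \<open>E\<close> can be transported along steps shorter than \<open>\<epsilon>\<close>, and a
  geodesic triangle with sides shorter than \<open>\<epsilon>\<close> lies in such a ball, so that transport along a chain
  depends only on its class.  Transporting \<open>e\<close> is therefore a bijection from the classes of chains
  to \<open>E\<close>.  It is an isometry since a chain lifts to a broken geodesic of the same length and a fine
  sample of a path is no longer than the path.
\<close>

section \<open>Homotopies of chains\<close>

text \<open>The constant fits both halves. On a geodesic shorter than
  \<open>3 * \<epsilon> / 2\<close>, the first third is shorter than \<open>\<epsilon> / 2\<close>,
  so any two division points are less than \<open>\<epsilon>\<close> apart by way of the apex, and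
  the remaining two thirds are shorter than \<open>\<epsilon>\<close>. Conversely, a point of a
  triangle is at most half the perimeter away from a vertex. The obstacle is that \<open>E\<close>
  is an abstract covering space, with a topology but no metric, and its sheets have no uniform size.
  The only information at a uniform scale is the lifting criterion for loops at \<open>b\<close>.
  Conjugation moves it to other base points; it then yields both the existence of lifts of short
  paths and the independence of their endpoints from the path. The opposite direction of the
  criterion gives injectivity on classes. The isometry does not yet give a homeomorphism: the
  topology of \<open>E\<close> must also be compared with the balls of the lifted length distance,
  for which small sheets suffice.\<close>

lemma eps_chain_append:
  assumes "us \<noteq> []" "vs \<noteq> []"
  shows "eps_chain X \<epsilon> (us @ vs) \<longleftrightarrow>
    eps_chain X \<epsilon> us \<and> eps_chain X \<epsilon> vs \<and> dist (last us) (hd vs) < \<epsilon>"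
  using assms by (auto simp: eps_chain_def successively_append_iff)

lemma eps_homotopic_append:
  assumes "eps_homotopic X \<epsilon> \<alpha> \<alpha>'" "eps_chain X \<epsilon> (\<alpha> @ \<beta>)" "\<alpha> \<noteq> []"
  shows "eps_homotopic X \<epsilon> (\<alpha> @ \<beta>) (\<alpha>' @ \<beta>)"
proof -
  have "eps_chain X \<epsilon> \<alpha>" "eps_chain X \<epsilon> (last \<alpha> # \<beta>)"
    using assms(2,3) by (cases \<beta>; auto simp: eps_chain_def successively_append_iff)+
  then show ?thesis using eps_homotopic_glue1[OF assms(1), of "last \<alpha> # \<beta>"] by simp
qed

lemma eps_homotopic_delete:
  assumes "eps_chain X \<epsilon> (us @ x # vs)" "us \<noteq> []" "vs \<noteq> []" "dist (last us) (hd vs) < \<epsilon>"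
  shows "eps_homotopic X \<epsilon> (us @ x # vs) (us @ vs)"
  by (rule eps_homotopic_remove) (use assms in \<open>auto simp: eps_chain_def successively_append_iff successively_Cons\<close>)

lemma eps_homotopic_delete_hd:
  assumes "eps_chain X \<epsilon> (x # x # vs)"
  shows "eps_homotopic X \<epsilon> (x # x # vs) (x # vs)"
  using eps_homotopic_remove[of X \<epsilon> "[x]" x vs] assms by (auto simp: eps_chain_def)

lemma eps_homotopic_delete_last:
  assumes "eps_chain X \<epsilon> (us @ [x, x])"
  shows "eps_homotopic X \<epsilon> (us @ [x, x]) (us @ [x])"
proof -
  have "eps_chain X \<epsilon> (us @ [x])" "hd (us @ [x]) = hd (us @ [x, x])"
    using assms by (auto simp: eps_chain_def successively_append_iff hd_append)
  then show ?thesis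
    using eps_homotopic_remove[of X \<epsilon> "us @ [x]" x "[]"] assms by simp
qed

text \<open>Classes of chains form a groupoid under gluing, with \<open>rev\<close> as inverse: the
  block \<open>rev \<alpha> @ tl \<alpha>\<close> contracts to its endpoint, which is the first
  point of \<open>\<beta>\<close>.\<close>

lemma eps_homotopic_cancel_left:
  assumes "\<epsilon> > 0" "eps_chain X \<epsilon> \<alpha>" "eps_chain X \<epsilon> \<beta>" "last \<alpha> = hd \<beta>"
  shows "eps_homotopic X \<epsilon> (rev \<alpha> @ tl (\<alpha> @ tl \<beta>)) \<beta>"
proof -
  have ne: "\<alpha> \<noteq> []" "\<beta> \<noteq> []" using assms by (auto simp: eps_chain_def)
  have "eps_homotopic X \<epsilon> (rev \<alpha> @ tl \<alpha>) [last \<alpha>]"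
    using eps_homotopic_rinv[of \<epsilon> X "rev \<alpha>"] assms ne by (simp add: eps_chain_rev hd_rev)
  then have "eps_homotopic X \<epsilon> ((rev \<alpha> @ tl \<alpha>) @ tl \<beta>) ([last \<alpha>] @ tl \<beta>)"
  proof (rule eps_homotopic_glue1)
    show "eps_chain X \<epsilon> (rev \<alpha> @ tl \<alpha>)"
      by (rule eps_chain_glue) (use assms ne in \<open>auto simp: eps_chain_rev last_rev\<close>)
    show "last (rev \<alpha> @ tl \<alpha>) = hd \<beta>"
      using last_glue[of \<alpha> "rev \<alpha>"] assms(4) ne by (simp add: last_rev)
  qed fact
  moreover have "[last \<alpha>] @ tl \<beta> = \<beta>" using assms(4) ne by (cases \<beta>) auto
  ultimately show ?thesis using ne by simp
qed

text \<open>Left cancellation in the groupoid of classes: glue \<open>rev \<alpha>\<close> in front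
  of both sides.\<close>

lemma eps_homotopic_glue_iff:
  assumes "\<epsilon> > 0" "eps_chain X \<epsilon> \<alpha>" "eps_chain X \<epsilon> \<beta>" "eps_chain X \<epsilon> \<beta>'" "last \<alpha> = hd \<beta>" "last \<alpha> = hd \<beta>'"
  shows "eps_homotopic X \<epsilon> (\<alpha> @ tl \<beta>) (\<alpha> @ tl \<beta>') \<longleftrightarrow> eps_homotopic X \<epsilon> \<beta> \<beta>'"
proof
  have ne: "\<alpha> \<noteq> []" "\<beta> \<noteq> []" using assms by (auto simp: eps_chain_def)
  assume "eps_homotopic X \<epsilon> (\<alpha> @ tl \<beta>) (\<alpha> @ tl \<beta>')"
  then have "eps_homotopic X \<epsilon> (rev \<alpha> @ tl (\<alpha> @ tl \<beta>)) (rev \<alpha> @ tl (\<alpha> @ tl \<beta>'))"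
    by (rule eps_homotopic_glue2)
      (use assms ne in \<open>auto simp: eps_chain_rev last_rev intro: eps_chain_glue\<close>)
  then show "eps_homotopic X \<epsilon> \<beta> \<beta>'"
    using eps_homotopic_cancel_left[OF assms(1,2,3,5)] eps_homotopic_cancel_left[OF assms(1,2,4,6)]
    by (meson eps_homotopic_sym eps_homotopic_trans)
qed (use eps_homotopic_glue2 assms in blast)

text \<open>Reversing the hypothesis makes \<open>\<beta>\<close> the common initial chain: both
  \<open>\<beta> @ tl (rev \<alpha>)\<close> and \<open>\<beta> @ tl (rev \<beta>)\<close> are null.
  Left cancellation then compares the reversals.\<close>

lemma eps_homotopic_cancel_right:
  assumes "\<epsilon> > 0" "eps_chain X \<epsilon> \<alpha>" "eps_chain X \<epsilon> \<beta>" "hd \<alpha> = hd \<beta>" "last \<alpha> = last \<beta>"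
    and "eps_homotopic X \<epsilon> (\<alpha> @ tl (rev \<beta>)) [hd \<beta>]"
  shows "eps_homotopic X \<epsilon> \<alpha> \<beta>"
proof -
  have ne: "\<alpha> \<noteq> []" "\<beta> \<noteq> []" using assms(2,3) by (auto simp: eps_chain_def)
  have ch: "eps_chain X \<epsilon> (\<alpha> @ tl (rev \<beta>))"
    by (rule eps_chain_glue) (use assms ne in \<open>auto simp: eps_chain_rev hd_rev\<close>)
  have "rev (\<alpha> @ tl (rev \<beta>)) = \<beta> @ tl (rev \<alpha>)"
    using ne assms(5) by (cases \<alpha> rule: rev_cases; cases \<beta> rule: rev_cases) auto
  then have "eps_homotopic X \<epsilon> (\<beta> @ tl (rev \<alpha>)) [hd \<beta>]"
    using eps_homotopic_rev[OF assms(6) ch] by simp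
  also have "eps_homotopic X \<epsilon> [hd \<beta>] (\<beta> @ tl (rev \<beta>))"
    by (rule eps_homotopic_sym[OF eps_homotopic_rinv[OF assms(1,3)]])
  finally have "eps_homotopic X \<epsilon> (rev \<alpha>) (rev \<beta>)"
    by (rule eps_homotopic_glue_iff[OF assms(1,3), THEN iffD1, rotated -1])
      (use assms(2,3,5) ne in \<open>simp_all add: eps_chain_rev hd_rev\<close>)
  then show ?thesis using eps_homotopic_rev[of X \<epsilon> "rev \<alpha>" "rev \<beta>"] assms(2) by (simp add: eps_chain_rev)
qed

text \<open>The triangles of the strip between two fine chains are removed one after the other.\<close>

lemma eps_homotopic_strip:
  fixes f g :: "nat \<Rightarrow> 'a::metric_space"
  assumes "\<And>i. i \<le> n \<Longrightarrow> f i \<in> X" "\<And>i. i \<le> n \<Longrightarrow> g i \<in> X"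
    and "\<And>i. i < n \<Longrightarrow> dist (f i) (f (Suc i)) < \<epsilon>" "\<And>i. i < n \<Longrightarrow> dist (g i) (g (Suc i)) < \<epsilon>"
    and "\<And>i. i \<le> n \<Longrightarrow> dist (f i) (g i) < \<epsilon>" "\<And>i. i < n \<Longrightarrow> dist (f i) (g (Suc i)) < \<epsilon>"
  shows "eps_chain X \<epsilon> (map f [0..<Suc n] @ [g n]) \<and>
    eps_homotopic X \<epsilon> (map f [0..<Suc n] @ [g n]) (f 0 # map g [0..<Suc n])"
  using assms
proof (induction n)
  case 0
  then show ?case by (auto simp: eps_chain_def)
next
  case (Suc n)
  have IH: "eps_chain X \<epsilon> (map f [0..<Suc n] @ [g n])"
    "eps_homotopic X \<epsilon> (map f [0..<Suc n] @ [g n]) (f 0 # map g [0..<Suc n])"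
    using Suc.IH Suc.prems by auto
  define F where "F = map f [0..<Suc n]"
  have F: "F \<noteq> []" "last F = f n" by (auto simp: F_def)
  have cF: "eps_chain X \<epsilon> F"
    using IH(1) by (auto simp: eps_chain_def F_def successively_append_iff)
  have c1: "eps_chain X \<epsilon> (F @ [f (Suc n), g (Suc n)])"
    using cF F Suc.prems by (auto simp: eps_chain_def successively_append_iff)
  have c2: "eps_chain X \<epsilon> (F @ [g n, g (Suc n)])"
    using cF F Suc.prems by (auto simp: eps_chain_def successively_append_iff)
  \<comment> \<open>The last square is crossed along its diagonal from \<open>f n\<close> to
    \<open>g (Suc n)\<close>: the corner \<open>f (Suc n)\<close> is dropped, then the opposite
    corner \<open>g n\<close> is inserted, which restores the chain of the induction
    hypothesis.\<close>
  have "eps_homotopic X \<epsilon> (F @ f (Suc n) # [g (Suc n)]) (F @ [g (Suc n)])"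
    using c1 F Suc.prems by (intro eps_homotopic_delete) auto
  also have "eps_homotopic X \<epsilon> (F @ [g (Suc n)]) (F @ g n # [g (Suc n)])"
    using c2 F Suc.prems by (intro eps_homotopic_sym[OF eps_homotopic_delete]) auto
  also have "eps_homotopic X \<epsilon> ((F @ [g n]) @ [g (Suc n)]) ((f 0 # map g [0..<Suc n]) @ [g (Suc n)])"
    using IH(2) c2 by (intro eps_homotopic_append) (auto simp: F_def)
  ultimately show ?case using c1 by (auto simp: F_def intro: eps_homotopic_trans)
qed

text \<open>When the ends agree, the two vertical edges of the strip degenerate to doubled
  endpoints, which can be deleted.\<close>

lemma eps_homotopic_parallel:
  fixes f g :: "nat \<Rightarrow> 'a::metric_space"
  assumes "\<And>i. i \<le> n \<Longrightarrow> f i \<in> X" "\<And>i. i \<le> n \<Longrightarrow> g i \<in> X"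
    and "\<And>i. i < n \<Longrightarrow> dist (f i) (f (Suc i)) < \<epsilon>" "\<And>i. i < n \<Longrightarrow> dist (g i) (g (Suc i)) < \<epsilon>"
    and "\<And>i. i \<le> n \<Longrightarrow> dist (f i) (g i) < \<epsilon>" "\<And>i. i < n \<Longrightarrow> dist (f i) (g (Suc i)) < \<epsilon>"
    and "f 0 = g 0" "f n = g n"
  shows "eps_homotopic X \<epsilon> (map f [0..<Suc n]) (map g [0..<Suc n])"
proof -
  have strip: "eps_chain X \<epsilon> (map f [0..<Suc n] @ [g n])"
    "eps_homotopic X \<epsilon> (map f [0..<Suc n] @ [g n]) (f 0 # map g [0..<Suc n])"
    using eps_homotopic_strip[of n f X g \<epsilon>] assms(1-6) by auto
  have g: "map g [0..<Suc n] = g 0 # map g [Suc 0..<Suc n]"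
    by (simp add: upt_conv_Cons del: upt_Suc)
  have "eps_homotopic X \<epsilon> (map f [0..<Suc n] @ [g n]) (map f [0..<Suc n])"
    using eps_homotopic_delete_last[of X \<epsilon> "map f [0..<n]" "g n"] strip(1) assms(8) by simp
  moreover have "eps_chain X \<epsilon> (f 0 # map g [0..<Suc n])"
    using eps_homotopicD strip by blast
  then have "eps_homotopic X \<epsilon> (f 0 # map g [0..<Suc n]) (map g [0..<Suc n])"
    using eps_homotopic_delete_hd[of X \<epsilon> "g 0"] assms(7) g by metis
  ultimately show ?thesis
    using strip(2) eps_homotopic_sym eps_homotopic_trans by metis
qed

text \<open>The edges from the apex \<open>x\<close> of a cone to the points \<open>y i\<close> are subdivided by the points \<open>q i\<close>.\<close>

lemma eps_homotopic_cone:
  fixes q y :: "nat \<Rightarrow> 'a::metric_space"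
  assumes "x \<in> X" "\<And>i. i \<le> n \<Longrightarrow> q i \<in> X" "\<And>i. i \<le> n \<Longrightarrow> y i \<in> X"
    and "\<And>i. i \<le> n \<Longrightarrow> dist x (q i) < \<epsilon>" "\<And>i. i \<le> n \<Longrightarrow> dist (q i) (y i) < \<epsilon>"
    and "\<And>i. i < n \<Longrightarrow> dist (y i) (y (Suc i)) < \<epsilon>"
    and "\<And>i. i < n \<Longrightarrow> dist (q i) (q (Suc i)) < \<epsilon>" "\<And>i. i < n \<Longrightarrow> dist (q i) (y (Suc i)) < \<epsilon>"
  shows "eps_chain X \<epsilon> ([x, q 0] @ map y [0..<Suc n]) \<and>
    eps_homotopic X \<epsilon> ([x, q 0] @ map y [0..<Suc n]) [x, q n, y n]"
  using assms
proof (induction n)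
  case 0
  then show ?case by (auto simp: eps_chain_def)
next
  case (Suc n)
  have IH: "eps_chain X \<epsilon> ([x, q 0] @ map y [0..<Suc n])"
    "eps_homotopic X \<epsilon> ([x, q 0] @ map y [0..<Suc n]) [x, q n, y n]"
    using Suc.IH Suc.prems by auto
  have c: "eps_chain X \<epsilon> (([x, q 0] @ map y [0..<Suc n]) @ [y (Suc n)])"
    by (rule eps_chain_append[THEN iffD2])
      (use IH(1) Suc.prems(3)[of "Suc n"] Suc.prems(6)[of n] in \<open>auto simp: eps_chain_def\<close>)
  have "eps_homotopic X \<epsilon> (([x, q 0] @ map y [0..<Suc n]) @ [y (Suc n)]) ([x, q n, y n] @ [y (Suc n)])"
    using IH(2) c by (rule eps_homotopic_append) simp
  also have "[x, q n, y n] @ [y (Suc n)] = [x, q n, y n, y (Suc n)]" by simp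
  \<comment> \<open>The new slice is crossed in three triangles: drop \<open>y n\<close>, insert
    \<open>q (Suc n)\<close>, drop \<open>q n\<close>. The apex is never adjacent to a point
    \<open>y i\<close>, whose distance from it may exceed \<open>\<epsilon>\<close>.\<close>
  also have "eps_homotopic X \<epsilon> [x, q n, y n, y (Suc n)] [x, q n, y (Suc n)]"
    using eps_homotopic_delete[of X \<epsilon> "[x, q n]" "y n" "[y (Suc n)]"] Suc.prems by (auto simp: eps_chain_def)
  also have "eps_homotopic X \<epsilon> [x, q n, y (Suc n)] [x, q n, q (Suc n), y (Suc n)]"
    using eps_homotopic_delete[of X \<epsilon> "[x, q n]" "q (Suc n)" "[y (Suc n)]"] Suc.prems
    by (auto simp: eps_chain_def intro: eps_homotopic_sym)
  also have "eps_homotopic X \<epsilon> [x, q n, q (Suc n), y (Suc n)] [x, q (Suc n), y (Suc n)]"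
    using eps_homotopic_delete[of X \<epsilon> "[x]" "q n" "[q (Suc n), y (Suc n)]"] Suc.prems
    by (auto simp: eps_chain_def)
  finally show ?case using c by simp
qed

section \<open>Lengths and geodesics\<close>

lemma chain_length_le_path_length:
  assumes "sorted ts" "set ts \<subseteq> {0..1}"
  shows "ennreal (chain_length (map g ts)) \<le> path_length g"
  unfolding path_length_def by (rule SUP_upper) (use assms in auto)

lemma path_length_cong:
  assumes "\<And>t. t \<in> {0..1} \<Longrightarrow> f t = g t"
  shows "path_length f = path_length g"
  unfolding path_length_def
proof (rule SUP_cong)
  fix ts assume "ts \<in> {ts. sorted ts \<and> set ts \<subseteq> {0..1::real}}"
  then have "map f ts = map g ts" using assms by auto
  then show "ennreal (chain_length (map f ts)) = ennreal (chain_length (map g ts))" by (simp only:)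
qed simp

text \<open>The triangle inequality at the inserted point \<open>m\<close>. One of the lists may be
  empty, as happens when all sample times of a joined path fall into the same half.\<close>

lemma chain_length_glue_le:
  assumes "xs @ ys \<noteq> []"
  shows "chain_length (xs @ ys) \<le> chain_length (xs @ [m]) + chain_length (m # ys)"
proof (cases "xs = [] \<or> ys = []")
  case True
  then show ?thesis
  proof
    assume "xs = []"
    then show ?thesis using assms by (cases ys) auto
  next
    assume "ys = []"
    moreover then have "xs \<noteq> []" using assms by simp
    then have "chain_length (xs @ [m]) = chain_length xs + dist (last xs) m"
      by (simp add: chain_length_append)
    ultimately show ?thesis by simp
  qed
next
  case False
  then obtain y zs where y: "ys = y # zs" by (cases ys) auto
  show ?thesis using False y dist_triangle[of "last xs" y m]
    by (simp add: chain_length_append)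
qed

lemma chain_length_Nil [simp]: "chain_length [] = 0"
  by (simp add: chain_length_def)

text \<open>Splitting the sample times at \<open>1/2\<close> and adding the junction to both parts
  can only increase the sampled length.\<close>

lemma path_length_join:
  assumes "pathfinish f = pathstart g"
  shows "path_length (f +++ g) \<le> path_length f + path_length g"
  unfolding path_length_def[of "f +++ g"]
proof (rule SUP_least)
  fix ts assume "ts \<in> {ts. sorted ts \<and> set ts \<subseteq> {0..1::real}}"
  then have ts: "sorted ts" "set ts \<subseteq> {0..1}" by auto
  define as bs where "as = filter (\<lambda>t. t \<le> 1/2) ts" and "bs = filter (\<lambda>t. \<not> t \<le> 1/2) ts"
  have "ts = as @ bs"
    using ts(1) unfolding as_def bs_def
  proof (induction ts)
    case (Cons t ts)
    show ?case
    proof (cases "t \<le> 1/2")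
      case False
      then have "filter (\<lambda>t. t \<le> 1/2) ts = []" "filter (\<lambda>t. \<not> t \<le> 1/2) ts = ts"
        using Cons.prems by (auto simp: filter_empty_conv filter_id_conv)
      then show ?thesis using False by simp
    qed (use Cons in simp)
  qed simp
  have as: "sorted as" "set as \<subseteq> {0..1/2}" and bs: "sorted bs" "set bs \<subseteq> {1/2..1}"
    using ts by (auto simp: as_def bs_def sorted_wrt_filter)
  \<comment> \<open>Each half is rescaled to the unit interval; the junction is added as time 1 of
    \<open>f\<close> and as time 0 of \<open>g\<close>.\<close>
  define as' bs' where "as' = map ((*) 2) as @ [1]" and "bs' = 0 # map (\<lambda>t. 2 * t - 1) bs"
  have 1: "sorted as'" "set as' \<subseteq> {0..1}" "sorted bs'" "set bs' \<subseteq> {0..1}"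
    using as bs by (auto simp: as'_def bs'_def sorted_append sorted_map sorted_wrt_map 
        intro!: sorted_wrt_mono_rel[of as "(\<le>)"] sorted_wrt_mono_rel[of bs "(\<le>)"])
  have a: "map (f +++ g) as @ [pathfinish f] = map f as'"
    using as(2) by (auto simp: as'_def joinpaths_def pathfinish_def)
  have b: "pathfinish f # map (f +++ g) bs = map g bs'"
    using bs assms by (auto simp: bs'_def bs_def joinpaths_def pathstart_def)
  have "chain_length (map (f +++ g) ts) \<le> chain_length (map f as') + chain_length (map g bs')"
  proof (cases "ts = []")
    case False
    then show ?thesis
      using chain_length_glue_le[of "map (f +++ g) as" "map (f +++ g) bs" "pathfinish f"] a b \<open>ts = as @ bs\<close> by simp
  qed simp
  then have "ennreal (chain_length (map (f +++ g) ts))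
      \<le> ennreal (chain_length (map f as')) + ennreal (chain_length (map g bs'))"
    by (metis chain_length_nonneg ennreal_leI ennreal_plus)
  also have "\<dots> \<le> path_length f + path_length g"
    by (intro add_mono chain_length_le_path_length 1)
  finally show "ennreal (chain_length (map (f +++ g) ts)) \<le> path_length f + path_length g" .
qed

text \<open>Path length is a supremum over samples, so no sample of a geodesic is longer than the
  distance of its ends. The sample \<open>[0, t, 1]\<close> gives the betweenness bound and
  \<open>[s, t]\<close> the diameter bound.\<close>

lemma geodesic_spaceE:
  assumes "geodesic_space X" "x \<in> X" "y \<in> X"
  obtains g where "path g" "path_image g \<subseteq> X" "pathstart g = x" "pathfinish g = y"
    "path_length g = ennreal (dist x y)"
    "\<And>t. t \<in> {0..1} \<Longrightarrow> dist x (g t) + dist (g t) y \<le> dist x y"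
    "\<And>s t. s \<in> {0..1} \<Longrightarrow> t \<in> {0..1} \<Longrightarrow> dist (g s) (g t) \<le> dist x y"
proof -
  obtain g where g: "path g" "path_image g \<subseteq> X" "pathstart g = x" "pathfinish g = y"
    "path_length g = ennreal (dist x y)"
    using assms unfolding geodesic_space_def by blast
  have len: "chain_length (map g ts) \<le> dist x y" if "sorted ts" "set ts \<subseteq> {0..1}" for ts
    using chain_length_le_path_length[OF that, of g] by (simp add: g)
  have "dist (g s) (g t) \<le> dist x y" if "s \<in> {0..1}" "t \<in> {0..1}" "s \<le> t" for s t
    using len[of "[s, t]"] that by simp
  then have "dist (g s) (g t) \<le> dist x y" if "s \<in> {0..1}" "t \<in> {0..1}" for s t
    using that by (metis dist_commute linear)
  moreover have "dist x (g t) + dist (g t) y \<le> dist x y" if "t \<in> {0..1}" for t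
    using len[of "[0, t, 1]"] that g(3,4) by (simp add: pathstart_def pathfinish_def)
  ultimately show ?thesis using that g by blast
qed

text \<open>The distance from \<open>x\<close> varies continuously along a geodesic, so it takes the
  value \<open>r\<close>; betweenness bounds the rest.\<close>

lemma geodesic_space_point:
  assumes "geodesic_space X" "x \<in> X" "y \<in> X" "0 \<le> r" "r \<le> dist x y"
  obtains z where "z \<in> X" "dist x z = r" "dist z y \<le> dist x y - r"
proof -
  from assms(1-3) obtain g where g: "path g" "path_image g \<subseteq> X" "pathstart g = x" "pathfinish g = y"
    "\<And>t. t \<in> {0..1} \<Longrightarrow> dist x (g t) + dist (g t) y \<le> dist x y"
    by (rule geodesic_spaceE) blast
  have "continuous_on {0..1} (\<lambda>t. dist x (g t))"
    using g(1) by (auto simp: path_def intro!: continuous_intros)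
  then obtain t where t: "t \<in> {0..1}" "dist x (g t) = r"
    using IVT'[of "\<lambda>t. dist x (g t)" 0 r 1] g(3,4) assms(4,5)
    by (auto simp: pathstart_def pathfinish_def)
  have "g t \<in> X" using g(2) t(1) by (auto simp: path_image_def)
  then show ?thesis using that[of "g t"] t g(5)[of t] by simp
qed

section \<open>Chains along paths\<close>

definition path_chain :: "(real \<Rightarrow> 'a) \<Rightarrow> nat \<Rightarrow> 'a list" where
  "path_chain g n = map (\<lambda>i. g (real i / real n)) [0..<Suc n]"

text \<open>The bound concerns all pairs of close parameters rather than consecutive sample times,
  which makes it monotone in \<open>n\<close>. Since \<open>1 / real 0 = 0\<close>, the case
  \<open>n = 0\<close> would otherwise be fine for every \<open>g\<close> when
  \<open>\<epsilon> > 0\<close>.\<close>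

definition fine_mesh :: "real \<Rightarrow> (real \<Rightarrow> 'a::metric_space) \<Rightarrow> nat \<Rightarrow> bool" where
  "fine_mesh \<epsilon> g n \<longleftrightarrow>
     n > 0 \<and> (\<forall>s\<in>{0..1}. \<forall>t\<in>{0..1}. \<bar>s - t\<bar> \<le> 1 / real n \<longrightarrow> dist (g s) (g t) < \<epsilon>)"

text \<open>The choice of \<open>n\<close> is immaterial for paths with a fine mesh, by
  \<open>path_class_eq\<close>. On loops this is the passage from homotopy classes of paths to
  classes of chains.\<close>

definition path_class :: "'a::metric_space set \<Rightarrow> real \<Rightarrow> (real \<Rightarrow> 'a) \<Rightarrow> 'a list set" where
  "path_class X \<epsilon> g = eps_class X \<epsilon> (path_chain g (SOME n. fine_mesh \<epsilon> g n))"

lemma fine_mesh_mono: "fine_mesh \<epsilon> g n \<Longrightarrow> n \<le> m \<Longrightarrow> fine_mesh \<epsilon> g m"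
  unfolding fine_mesh_def by (force simp: frac_le intro: order_trans)

lemma fine_mesh_le: "fine_mesh \<eta> g n \<Longrightarrow> \<eta> \<le> \<epsilon> \<Longrightarrow> fine_mesh \<epsilon> g n"
  unfolding fine_mesh_def by force

lemma fine_mesh_pos: "fine_mesh \<epsilon> g n \<Longrightarrow> n > 0"
  by (simp add: fine_mesh_def)

lemma ex_fine_mesh:
  assumes "path g" "\<epsilon> > 0"
  shows "\<exists>n. fine_mesh \<epsilon> g n"
proof -
  have "uniformly_continuous_on {0..1} g"
    using assms(1) by (simp add: path_def compact_uniformly_continuous)
  then obtain d where d: "d > 0"
    "\<And>s t. s \<in> {0..1} \<Longrightarrow> t \<in> {0..1} \<Longrightarrow> dist s t < d \<Longrightarrow> dist (g s) (g t) < \<epsilon>"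
    using assms(2) unfolding uniformly_continuous_on_def by metis
  obtain n where "n > 0" "1 / real n < d"
    using d(1) reals_Archimedean[of d] by (auto simp: inverse_eq_divide intro: that[of "Suc _"])
  then show ?thesis using d(2) by (auto simp: fine_mesh_def dist_real_def)
qed

lemma length_path_chain [simp]: "length (path_chain g n) = Suc n"
  by (simp add: path_chain_def)

lemma nth_path_chain: "i \<le> n \<Longrightarrow> path_chain g n ! i = g (real i / real n)"
  unfolding path_chain_def by (subst nth_map) (auto simp: nth_append)

lemma path_chain_0 [simp]: "path_chain g n \<noteq> []" "hd (path_chain g n) = pathstart g"
  by (simp_all add: path_chain_def pathstart_def hd_map del: upt_Suc)

lemma last_path_chain [simp]: "n > 0 \<Longrightarrow> last (path_chain g n) = pathfinish g"
  by (simp add: path_chain_def pathfinish_def last_map)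

lemma eps_chain_map:
  assumes "\<And>i. i \<le> n \<Longrightarrow> f i \<in> X" "\<And>i. i < n \<Longrightarrow> dist (f i) (f (Suc i)) < \<epsilon>"
  shows "eps_chain X \<epsilon> (map f [0..<Suc n])"
  using assms
  by (auto simp: eps_chain_def successively_conv_nth nth_append simp del: upt_Suc)

lemma fine_meshD:
  assumes "fine_mesh \<epsilon> g n" "0 \<le> s" "s \<le> 1" "0 \<le> t" "t \<le> 1" "\<bar>s - t\<bar> \<le> 1 / real n"
  shows "dist (g s) (g t) < \<epsilon>"
  using assms by (auto simp: fine_mesh_def)

lemma fine_mesh_step:
  assumes "fine_mesh \<epsilon> g n" "i < n"
  shows "dist (g (real i / real n)) (g (real (Suc i) / real n)) < \<epsilon>"
  by (rule fine_meshD[OF assms(1)]) (use assms in \<open>auto simp: field_simps\<close>)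

lemma eps_chain_path_chain:
  assumes "fine_mesh \<epsilon> g n" "path_image g \<subseteq> X"
  shows "eps_chain X \<epsilon> (path_chain g n)"
  unfolding path_chain_def
proof (rule eps_chain_map)
  fix i assume "i \<le> n"
  then have "real i / real n \<in> {0..1}" by (simp add: divide_le_eq)
  then show "g (real i / real n) \<in> X" using assms(2) by (auto simp: path_image_def)
qed (rule fine_mesh_step[OF assms(1)])

text \<open>The two subdivisions interlace:
  \<open>i / (n + 1) \<le> i / n \<le> (i + 1) / (n + 1)\<close>. Hence all edges of the strip
  between the two samples span parameters at most \<open>1 / n\<close> apart.\<close>

lemma path_chain_Suc_homotopic:
  assumes fine: "fine_mesh \<epsilon> g n" and X: "path_image g \<subseteq> X"
  shows "eps_homotopic X \<epsilon> (path_chain g n) (path_chain g (Suc n))"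
proof -
  have n: "n > 0" using fine by (simp add: fine_mesh_def)
  \<comment> \<open>Capping at 1 repeats the endpoint once, so that both samples have
    \<open>n + 2\<close> entries.\<close>
  define s t where "s i = min 1 (real i / real n)" and "t i = real i / real (Suc n)" for i
  have st: "0 \<le> s i" "s i \<le> 1" "0 \<le> t i" "i \<le> Suc n \<Longrightarrow> t i \<le> 1" for i
    by (auto simp: s_def t_def)
  have inX: "g u \<in> X" if "0 \<le> u" "u \<le> 1" for u
    using X that by (auto simp: path_image_def)
  have tn: "1 / real (Suc n) \<le> 1 / real n" using n by (simp add: field_simps)
  have 1: "\<bar>s i - s (Suc i)\<bar> \<le> 1 / real n" for i
    using n by (auto simp: s_def min_def field_simps)
  have 2: "\<bar>t i - t (Suc i)\<bar> \<le> 1 / real n" for i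
  proof -
    have "t (Suc i) = t i + 1 / real (Suc n)" by (simp add: t_def add_divide_distrib)
    then show ?thesis using tn by simp
  qed
  have ti: "t i \<le> s i" "s i \<le> t (Suc i)" if "i \<le> Suc n" for i
    using n that by (auto simp: s_def t_def min_def field_simps)
  have 3: "\<bar>s i - t i\<bar> \<le> 1 / real n" "\<bar>s i - t (Suc i)\<bar> \<le> 1 / real n" if "i \<le> Suc n" for i
    using ti[OF that] 2[of i] by linarith+
  have "eps_homotopic X \<epsilon> (map (\<lambda>i. g (s i)) [0..<Suc (Suc n)]) (map (\<lambda>i. g (t i)) [0..<Suc (Suc n)])"
  proof (rule eps_homotopic_parallel)
    show "g (s 0) = g (t 0)" "g (s (Suc n)) = g (t (Suc n))"
      using n by (simp_all add: s_def t_def min_def)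
  qed (use st inX 1 2 3 in \<open>auto intro!: fine_meshD[OF fine]\<close>)
  moreover have "map (\<lambda>i. g (t i)) [0..<Suc (Suc n)] = path_chain g (Suc n)"
    by (simp add: path_chain_def t_def)
  moreover have "map (\<lambda>i. g (s i)) [0..<Suc (Suc n)] = path_chain g n @ [pathfinish g]"
    using n by (auto simp: path_chain_def s_def pathfinish_def min_def)
  moreover have "eps_homotopic X \<epsilon> (path_chain g n @ [pathfinish g]) (path_chain g n)"
  proof -
    have pc: "path_chain g n = map (\<lambda>i. g (real i / real n)) [0..<n] @ [pathfinish g]"
      using n by (simp add: path_chain_def pathfinish_def)
    have "eps_chain X \<epsilon> (path_chain g n @ [pathfinish g])"
      using eps_chain_path_chain[OF fine X] n fine_meshD[OF fine, of 1 1]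
      by (subst eps_chain_append) (auto simp: pathfinish_def eps_chain_def intro: inX)
    then show ?thesis
      using eps_homotopic_delete_last[of X \<epsilon> "map (\<lambda>i. g (real i / real n)) [0..<n]" "pathfinish g"]
      by (simp add: pc)
  qed
  ultimately show ?thesis
    using eps_homotopic_sym eps_homotopic_trans by metis
qed

lemma path_chain_homotopic:
  assumes "fine_mesh \<epsilon> g n" "fine_mesh \<epsilon> g m" "path_image g \<subseteq> X"
  shows "eps_homotopic X \<epsilon> (path_chain g n) (path_chain g m)"
proof -
  have "eps_homotopic X \<epsilon> (path_chain g n) (path_chain g (n + k))" if "fine_mesh \<epsilon> g n" for n k
  proof (induction k)
    case (Suc k)
    have "fine_mesh \<epsilon> g (n + k)" using that by (rule fine_mesh_mono) simp
    then show ?case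
      using Suc path_chain_Suc_homotopic[OF _ assms(3)] by (metis add_Suc_right eps_homotopic_trans)
  qed simp
  then show ?thesis
    using assms(1,2) eps_homotopic_sym by (metis le_add_diff_inverse linear)
qed

lemma path_class_eq:
  assumes "fine_mesh \<epsilon> g n" "path_image g \<subseteq> X"
  shows "path_class X \<epsilon> g = eps_class X \<epsilon> (path_chain g n)"
  unfolding path_class_def eps_class_eq_iff
  by (rule path_chain_homotopic[OF someI[of "fine_mesh \<epsilon> g"]]) (use assms in auto)

text \<open>With \<open>2 * n\<close> intervals the junction time \<open>1/2\<close> is itself a
  sample time, and each half is sampled exactly as before joining.\<close>

lemma path_chain_join:
  assumes "pathfinish f = pathstart g" "n > 0"
  shows "path_chain (f +++ g) (2 * n) = path_chain f n @ tl (path_chain g n)"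
proof (rule nth_equalityI)
  fix i assume "i < length (path_chain (f +++ g) (2 * n))"
  then have i: "i \<le> 2 * n" by simp
  have l: "path_chain (f +++ g) (2 * n) ! i = (f +++ g) (real i / real (2 * n))"
    using i by (simp add: nth_path_chain)
  show "path_chain (f +++ g) (2 * n) ! i = (path_chain f n @ tl (path_chain g n)) ! i"
  proof (cases "i \<le> n")
    case True
    then have "(path_chain f n @ tl (path_chain g n)) ! i = f (real i / real n)"
      by (simp add: nth_path_chain nth_append)
    moreover have "real i / real (2 * n) \<le> 1/2" "2 * (real i / real (2 * n)) = real i / real n"
      using True assms(2) by (auto simp: field_simps)
    ultimately show ?thesis unfolding l by (simp add: joinpaths_def)
  next
    case False
    then have "(path_chain f n @ tl (path_chain g n)) ! i = g (real (i - n) / real n)"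
      using i by (simp add: nth_path_chain nth_append nth_tl Suc_diff_Suc del: of_nat_diff)
    moreover have "\<not> real i / real (2 * n) \<le> 1/2" "2 * (real i / real (2 * n)) - 1 = real (i - n) / real n"
      using False assms(2) by (auto simp: field_simps of_nat_diff)
    ultimately show ?thesis unfolding l by (simp add: joinpaths_def)
  qed
qed simp

lemma path_chain_reversepath:
  assumes "n > 0"
  shows "path_chain (reversepath g) n = rev (path_chain g n)"
proof (rule nth_equalityI)
  fix i assume "i < length (path_chain (reversepath g) n)"
  then have i: "i \<le> n" by simp
  then have "1 - real i / real n = real (n - i) / real n"
    using assms by (simp add: field_simps of_nat_diff)
  then show "path_chain (reversepath g) n ! i = rev (path_chain g n) ! i"
    using i by (simp add: nth_path_chain reversepath_def rev_nth del: of_nat_diff)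
qed simp

section \<open>Classes of short paths, of joins and reversals, and of homotopic paths\<close>

lemma path_class_short:
  assumes "path_image g \<subseteq> X" "\<And>s t. s \<in> {0..1} \<Longrightarrow> t \<in> {0..1} \<Longrightarrow> dist (g s) (g t) < \<epsilon>"
  shows "path_class X \<epsilon> g = eps_class X \<epsilon> [pathstart g, pathfinish g]"
proof -
  have "fine_mesh \<epsilon> g 1" using assms(2) by (simp add: fine_mesh_def)
  then show ?thesis using assms(1)
    by (simp add: path_class_eq path_chain_def pathstart_def pathfinish_def)
qed

lemma path_class_join:
  assumes "path f" "path g" "path_image f \<subseteq> X" "path_image g \<subseteq> X" "pathfinish f = pathstart g" "\<epsilon> > 0"
    and "path_class X \<epsilon> f = eps_class X \<epsilon> \<alpha>" "path_class X \<epsilon> g = eps_class X \<epsilon> \<beta>"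
  shows "path_class X \<epsilon> (f +++ g) = eps_class X \<epsilon> (\<alpha> @ tl \<beta>)"
proof -
  obtain n1 n2 n3 where "fine_mesh \<epsilon> f n1" "fine_mesh \<epsilon> g n2" "fine_mesh \<epsilon> (f +++ g) n3"
    using ex_fine_mesh[of _ \<epsilon>] assms by (metis path_join)
  \<comment> \<open>The sum dominates all three meshes, so by monotonicity one \<open>n\<close>
    serves both pieces and \<open>2 * n\<close> serves the join.\<close>
  moreover define n where "n = n1 + n2 + n3"
  ultimately have n: "fine_mesh \<epsilon> f n" "fine_mesh \<epsilon> g n" "fine_mesh \<epsilon> (f +++ g) (2 * n)" "n > 0"
    using fine_mesh_pos by (auto elim: fine_mesh_mono)
  have f: "eps_chain X \<epsilon> (path_chain f n)" "eps_homotopic X \<epsilon> (path_chain f n) \<alpha>"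
    using eps_chain_path_chain path_class_eq n assms by (metis eps_class_eq_iff)+
  have g: "eps_chain X \<epsilon> (path_chain g n)" "eps_homotopic X \<epsilon> (path_chain g n) \<beta>"
    using eps_chain_path_chain path_class_eq n assms by (metis eps_class_eq_iff)+
  have "path_class X \<epsilon> (f +++ g) = eps_class X \<epsilon> (path_chain f n @ tl (path_chain g n))"
    using path_class_eq[OF n(3)] path_chain_join[OF assms(5) n(4)] assms by (simp add: subset_path_image_join)
  also have "\<dots> = eps_class X \<epsilon> (\<alpha> @ tl (path_chain g n))"
    unfolding eps_class_eq_iff using f g n assms by (intro eps_homotopic_glue1) auto
  also have "\<dots> = eps_class X \<epsilon> (\<alpha> @ tl \<beta>)"
    unfolding eps_class_eq_iff using f g n assms eps_homotopicD[OF f(2,1)]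
    by (intro eps_homotopic_glue2) auto
  finally show ?thesis .
qed

lemma path_class_reversepath:
  assumes "path g" "path_image g \<subseteq> X" "\<epsilon> > 0" "path_class X \<epsilon> g = eps_class X \<epsilon> \<alpha>"
  shows "path_class X \<epsilon> (reversepath g) = eps_class X \<epsilon> (rev \<alpha>)"
proof -
  obtain n1 n2 where "fine_mesh \<epsilon> g n1" "fine_mesh \<epsilon> (reversepath g) n2"
    using ex_fine_mesh[of _ \<epsilon>] assms by (metis path_reversepath)
  moreover define n where "n = n1 + n2"
  ultimately have n: "fine_mesh \<epsilon> g n" "fine_mesh \<epsilon> (reversepath g) n" "n > 0"
    using fine_mesh_pos by (auto elim: fine_mesh_mono)
  have g: "eps_chain X \<epsilon> (path_chain g n)" "eps_homotopic X \<epsilon> (path_chain g n) \<alpha>"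
    using eps_chain_path_chain path_class_eq n assms by (metis eps_class_eq_iff)+
  have "path_class X \<epsilon> (reversepath g) = eps_class X \<epsilon> (rev (path_chain g n))"
    using path_class_eq[OF n(2)] assms by (simp add: path_chain_reversepath[OF n(3)])
  also have "\<dots> = eps_class X \<epsilon> (rev \<alpha>)"
    unfolding eps_class_eq_iff using g by (intro eps_homotopic_rev)
  finally show ?thesis .
qed

text \<open>Sample the homotopy on a fine square grid. Neighbouring rows are parallel chains with
  the same ends, hence homotopic, and the extreme rows sample \<open>f\<close> and
  \<open>g\<close>.\<close>

lemma path_class_homotopic_paths:
  assumes "homotopic_paths X f g" "\<epsilon> > 0"
  shows "path_class X \<epsilon> f = path_class X \<epsilon> g"
proof -
  obtain H :: "real \<times> real \<Rightarrow> 'a" where H: "continuous_on ({0..1} \<times> {0..1}) H" "H \<in> {0..1} \<times> {0..1} \<rightarrow> X"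
    "\<forall>t\<in>{0..1}. H (0, t) = f t" "\<forall>t\<in>{0..1}. H (1, t) = g t"
    "\<forall>t\<in>{0..1}. H (t, 0) = pathstart f \<and> H (t, 1) = pathfinish f"
    using assms(1) unfolding homotopic_paths by (simp add: pathstart_def pathfinish_def) blast
  have im: "path_image f \<subseteq> X" "path_image g \<subseteq> X"
    using assms(1) homotopic_paths_imp_subset by blast+
  have "uniformly_continuous_on ({0..1} \<times> {0..1}) H"
    using H(1) by (simp add: compact_uniformly_continuous compact_Times)
  then obtain d where d: "d > 0"
    "\<And>y z. y \<in> {0..1} \<times> {0..1} \<Longrightarrow> z \<in> {0..1} \<times> {0..1} \<Longrightarrow> dist y z < d \<Longrightarrow> dist (H y) (H z) < \<epsilon>"
    using assms(2) unfolding uniformly_continuous_on_def by metis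
  \<comment> \<open>A diagonal edge of the grid changes both coordinates, each by less than
    \<open>d / 2\<close>; the product distance is at most the sum of the changes.\<close>
  obtain n where n: "n > 0" "1 / real n < d / 2"
    using d(1) reals_Archimedean[of "d/2"] by (auto simp: inverse_eq_divide intro: that[of "Suc _"])
  have near: "dist (H (s, t)) (H (s', t')) < \<epsilon>"
    if "s \<in> {0..1}" "t \<in> {0..1}" "s' \<in> {0..1}" "t' \<in> {0..1}" "\<bar>s - s'\<bar> \<le> 1 / real n" "\<bar>t - t'\<bar> \<le> 1 / real n"
    for s t s' t'
  proof (rule d(2))
    have "dist (s, t) (s', t') \<le> \<bar>s - s'\<bar> + \<bar>t - t'\<bar>"
      by (simp add: dist_prod_def dist_real_def sqrt_sum_squares_le_sum_abs)
    then show "dist (s, t) (s', t') < d" using that n(2) by linarith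
  qed (use that in auto)
  have I: "real i / real n \<in> {0..1}" if "i \<le> n" for i using that by (simp add: divide_le_eq)
  have step: "\<bar>real i / real n - real (Suc i) / real n\<bar> \<le> 1 / real n" for i
    using n(1) by (simp add: field_simps)
  let ?r = "\<lambda>j. path_chain (\<lambda>t. H (real j / real n, t)) n"
  have "eps_homotopic X \<epsilon> (?r j) (?r (Suc j))" if "j < n" for j
    unfolding path_chain_def
  proof (rule eps_homotopic_parallel)
    show "H (real j / real n, real 0 / real n) = H (real (Suc j) / real n, real 0 / real n)"
      "H (real j / real n, real n / real n) = H (real (Suc j) / real n, real n / real n)"
      using I[of j] I[of "Suc j"] that n by (simp_all add: H)
  next
    fix i
    show "dist (H (real j / real n, real i / real n)) (H (real (Suc j) / real n, real (Suc i) / real n)) < \<epsilon>"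
      if "i < n" using that \<open>j < n\<close> step I by (intro near) (auto simp del: of_nat_Suc)
    show "dist (H (real j / real n, real i / real n)) (H (real j / real n, real (Suc i) / real n)) < \<epsilon>"
      if "i < n" using that \<open>j < n\<close> step I by (intro near) (auto simp del: of_nat_Suc)
    show "dist (H (real (Suc j) / real n, real i / real n)) (H (real (Suc j) / real n, real (Suc i) / real n)) < \<epsilon>"
      if "i < n" using that \<open>j < n\<close> step I by (intro near) (auto simp del: of_nat_Suc)
    show "dist (H (real j / real n, real i / real n)) (H (real (Suc j) / real n, real i / real n)) < \<epsilon>"
      if "i \<le> n" using that \<open>j < n\<close> step I by (intro near) (auto simp del: of_nat_Suc)
    show "H (real j / real n, real i / real n) \<in> X" "H (real (Suc j) / real n, real i / real n) \<in> X"
      if "i \<le> n" using that \<open>j < n\<close> H(2) I[of i] I[of j] I[of "Suc j"] by auto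
  qed
  then have "j \<le> n \<Longrightarrow> eps_homotopic X \<epsilon> (?r 0) (?r j)" for j
    by (induction j) (auto intro: eps_homotopic_trans)
  from this[of n] have "eps_homotopic X \<epsilon> (?r 0) (?r n)" by simp
  moreover have "?r 0 = path_chain f n" "?r n = path_chain g n"
    using H(3,4) I n(1) by (auto simp: path_chain_def simp del: upt_Suc)
  moreover have "fine_mesh \<epsilon> f n" "fine_mesh \<epsilon> g n"
    using near[of 0 _ 0] near[of 1 _ 1] n(1) H(3,4) by (auto simp: fine_mesh_def)
  ultimately show ?thesis
    using path_class_eq im by (metis eps_class_eq_iff)
qed

section \<open>Loops in small balls\<close>

lemma path_class_small_loop:
  assumes X: "geodesic_space X" and "\<epsilon> > 0" and g: "g \<in> loops X z" 
    and x: "x \<in> X" "path_image g \<subseteq> ball x (3 * \<epsilon> / 2)"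
  shows "path_class X \<epsilon> g = eps_class X \<epsilon> [z]"
proof -
  have g': "path g" "path_image g \<subseteq> X" "pathstart g = z" "pathfinish g = z" "z \<in> X"
    using g by (auto simp: loops_def)
  obtain w where w: "w \<in> path_image g" "\<And>y. y \<in> path_image g \<Longrightarrow> dist x y \<le> dist x w"
    using distance_attains_sup[of "path_image g" x] compact_path_image[OF g'(1)] by auto
  \<comment> \<open>The image of the loop is compact, so its farthest point \<open>w\<close> is
    still strictly inside the ball. What the longest two-thirds segment leaves below
    \<open>\<epsilon>\<close> is a positive mesh: then a division point is also within
    \<open>\<epsilon>\<close> of the next sample point.\<close>
  define \<eta> where "\<eta> = \<epsilon> - 2 * dist x w / 3"
  have w': "dist x w < 3 * \<epsilon> / 2" using x w by auto
  then have \<eta>: "\<eta> > 0" "\<eta> \<le> \<epsilon>" by (auto simp: \<eta>_def)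
  have "\<exists>q. q \<in> X \<and> dist x q = dist x y / 3 \<and> dist q y \<le> 2 * dist x y / 3" if "y \<in> X" for y
    using geodesic_space_point[OF X x(1) that, of "dist x y / 3"] by force
  then obtain Q where Q: "\<And>y. y \<in> X \<Longrightarrow> Q y \<in> X" "\<And>y. y \<in> X \<Longrightarrow> dist x (Q y) = dist x y / 3"
    "\<And>y. y \<in> X \<Longrightarrow> dist (Q y) y \<le> 2 * dist x y / 3" by metis
  obtain n where n: "fine_mesh \<eta> g n" using ex_fine_mesh g'(1) \<eta>(1) by blast
  then have n\<epsilon>: "fine_mesh \<epsilon> g n" "n > 0" using fine_mesh_le[OF _ \<eta>(2)] fine_mesh_pos by blast+
  define y where "y i = g (real i / real n)" for i
  have y: "y i \<in> path_image g" if "i \<le> n" for i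
  proof -
    have "real i / real n \<in> {0..1}" using that by (simp add: divide_le_eq)
    then show ?thesis by (auto simp: y_def path_image_def)
  qed
  then have yX: "y i \<in> X" "dist x (y i) \<le> dist x w" if "i \<le> n" for i using that g'(2) w by auto
  have yy: "dist (y i) (y (Suc i)) < \<eta>" if "i < n" for i
    unfolding y_def by (rule fine_mesh_step[OF n that])
  have d1: "dist x (Q (y i)) < \<epsilon> / 2" "dist (Q (y i)) (y i) \<le> 2 * dist x w / 3" if "i \<le> n" for i
    using Q[of "y i"] yX[OF that] w' by auto
  have ends: "y 0 = z" "y n = z" using g' n\<epsilon> by (simp_all add: y_def pathstart_def pathfinish_def)
  have chain: "path_chain g n = map y [0..<Suc n]" by (simp add: path_chain_def y_def)
  have "eps_homotopic X \<epsilon> ([x, Q (y 0)] @ map y [0..<Suc n]) [x, Q (y n), y n]"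
  proof (rule conjunct2[OF eps_homotopic_cone])
    fix i assume "i < n"
    then have i: "i \<le> n" "Suc i \<le> n" by auto
    show "dist (Q (y i)) (Q (y (Suc i))) < \<epsilon>"
      using d1(1)[OF i(1)] d1(1)[OF i(2)] dist_triangle[of "Q (y i)" "Q (y (Suc i))" x]
      by (simp add: dist_commute)
    show "dist (Q (y i)) (y (Suc i)) < \<epsilon>"
      using d1(2)[OF i(1)] yy[OF \<open>i < n\<close>] dist_triangle[of "Q (y i)" "y (Suc i)" "y i"]
      by (simp add: \<eta>_def)
    show "dist (y i) (y (Suc i)) < \<epsilon>" using yy[OF \<open>i < n\<close>] \<eta>(2) by simp
  next
    fix i assume "i \<le> n"
    show "dist x (Q (y i)) < \<epsilon>" using d1(1)[OF \<open>i \<le> n\<close>] assms(2) by simp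
    show "dist (Q (y i)) (y i) < \<epsilon>" using d1(2)[OF \<open>i \<le> n\<close>] w' by simp
  qed (use x Q yX in auto)
  \<comment> \<open>Because the loop closes up at \<open>z\<close>, both ends of the cone run along
    the same chain \<open>[x, Q z, z]\<close>, which can be cancelled.\<close>
  then have "eps_homotopic X \<epsilon> ([x, Q z, z] @ tl (path_chain g n)) ([x, Q z, z] @ tl [z])"
    using ends by (simp add: chain upt_conv_Cons del: upt_Suc)
  then have "eps_homotopic X \<epsilon> (path_chain g n) [z]"
  proof (subst (asm) eps_homotopic_glue_iff)
    show "eps_chain X \<epsilon> (path_chain g n)" by (rule eps_chain_path_chain[OF n\<epsilon>(1) g'(2)])
    show "eps_chain X \<epsilon> [x, Q z, z]"
      using x(1) Q(1)[of z] g'(5) d1[of 0] ends w' assms(2) by (auto simp: eps_chain_def)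
  qed (use g' assms(2) in \<open>auto simp: eps_chain_def\<close>)
  then show ?thesis
    using path_class_eq[OF n\<epsilon>(1) g'(2)] by (simp add: eps_class_eq_iff)
qed

lemma path_class_const:
  assumes "geodesic_space X" "\<epsilon> > 0" "x \<in> X"
  shows "path_class X \<epsilon> (\<lambda>_. x) = eps_class X \<epsilon> [x]"
  by (rule path_class_small_loop[OF assms(1,2) const_loop[OF assms(3)] assms(3)])
    (use assms(2) in \<open>auto simp: path_image_def\<close>)

lemma path_class_small_loop_subgroup:
  assumes X: "geodesic_space X" "b \<in> X" and \<epsilon>: "\<epsilon> > 0" and g: "g \<in> loops X b"
    and "loop_class X g \<in> small_loop_subgroup X b (3 * \<epsilon> / 2)"
  shows "path_class X \<epsilon> g = eps_class X \<epsilon> [b]"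
proof -
  let ?G = "fundamental_group X b"
  interpret G: group ?G by (rule group_fundamental_group[OF X(2)])
  have carr: "carrier ?G = loop_class X ` loops X b" and one: "\<one>\<^bsub>?G\<^esub> = loop_class X (\<lambda>_. b)"
    by (auto simp: fundamental_group_def)
  have join: "f +++ g \<in> loops X b" if "f \<in> loops X b" "g \<in> loops X b" for f g
    using that by (auto simp: loops_def subset_path_image_join)
  \<comment> \<open>Elements of the group are sets of loops, so being null is expressed through some
    representative. Homotopy invariance of \<open>path_class\<close> transfers it to the given loop
    at the end.\<close>
  let ?P = "\<lambda>A. \<exists>f\<in>loops X b. A = loop_class X f \<and> path_class X \<epsilon> f = eps_class X \<epsilon> [b]"
  have const: "path_class X \<epsilon> (\<lambda>_. b) = eps_class X \<epsilon> [b]"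
    using path_class_small_loop[OF X(1) \<epsilon> const_loop[OF X(2)] X(2)] \<epsilon> by (auto simp: path_image_def)
  have small: "?P A" if "A \<in> small_loop_classes X b (3 * \<epsilon> / 2)" for A
  proof -
    obtain c L x where A: "A = loop_class X (c +++ L +++ reversepath c)"
      and c: "path c" "path_image c \<subseteq> X" "pathstart c = b"
      and L: "L \<in> loops X (pathfinish c)" and x: "x \<in> X" "path_image L \<subseteq> ball x (3 * \<epsilon> / 2)"
      using \<open>A \<in> _\<close> unfolding small_loop_classes_def by blast
    have L': "path L" "path_image L \<subseteq> X" "pathstart L = pathfinish c" "pathfinish L = pathfinish c"
      using L by (auto simp: loops_def)
    obtain n where n: "fine_mesh \<epsilon> c n" using ex_fine_mesh c(1) \<epsilon> by blast
    define \<kappa> where "\<kappa> = path_chain c n"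
    have \<kappa>: "path_class X \<epsilon> c = eps_class X \<epsilon> \<kappa>" "eps_chain X \<epsilon> \<kappa>" "hd \<kappa> = b"
      unfolding \<kappa>_def using path_class_eq[OF n c(2)] eps_chain_path_chain[OF n c(2)] c(3) by auto
    have "path_class X \<epsilon> (L +++ reversepath c) = eps_class X \<epsilon> ([pathfinish c] @ tl (rev \<kappa>))"
      by (rule path_class_join[OF _ _ _ _ _ \<epsilon> path_class_small_loop[OF X(1) \<epsilon> L x] path_class_reversepath[OF c(1,2) \<epsilon> \<kappa>(1)]])
        (use c L' in auto)
    moreover have "[pathfinish c] @ tl (rev \<kappa>) = rev \<kappa>"
      using n last_path_chain[of n c] \<kappa>_def
      by (metis append_Cons append_Nil fine_mesh_def hd_rev list.collapse path_chain_0(1) rev_is_Nil_conv)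
    ultimately have "path_class X \<epsilon> (c +++ L +++ reversepath c) = eps_class X \<epsilon> (\<kappa> @ tl (rev \<kappa>))"
      by (intro path_class_join \<kappa>(1) \<epsilon>) (use c L' in \<open>auto simp: subset_path_image_join\<close>)
    also have "\<dots> = eps_class X \<epsilon> [b]"
      unfolding eps_class_eq_iff using eps_homotopic_rinv[OF \<epsilon> \<kappa>(2)] \<kappa>(3) by simp
    finally show ?thesis
      using A c L' by (intro bexI[of _ "c +++ L +++ reversepath c"]) (auto simp: loops_def subset_path_image_join)
  qed
  from assms(5) have "?P (loop_class X g)"
    unfolding small_loop_subgroup_def
  proof (induction rule: generate.induct)
    case one
    show ?case using const const_loop[OF X(2)] unfolding \<open>\<one>\<^bsub>?G\<^esub> = _\<close> by blast
  next
    case (incl h)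
    then show ?case by (rule small)
  next
    case (inv h)
    \<comment> \<open>\<open>generate\<close> inverts only generators, so the representative comes
      from \<open>small\<close>.\<close>
    then obtain f where f: "f \<in> loops X b" "h = loop_class X f" "path_class X \<epsilon> f = eps_class X \<epsilon> [b]"
      using small by blast
    have r: "reversepath f \<in> loops X b" using f(1) by (auto simp: loops_def)
    have "loop_class X (reversepath f) \<otimes>\<^bsub>?G\<^esub> loop_class X f = \<one>\<^bsub>?G\<^esub>"
      using homotopic_paths_inv_left[of f X] f(1) r join[OF r f(1)]
      by (simp add: one mult_fundamental_group loop_class_eq_iff) (auto simp: loops_def)
    then have "inv\<^bsub>?G\<^esub> h = loop_class X (reversepath f)"
      using f r by (intro G.inv_equality) (auto simp: carr)
    moreover have "path_class X \<epsilon> (reversepath f) = eps_class X \<epsilon> (rev [b])"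
      using f by (intro path_class_reversepath \<epsilon>) (auto simp: loops_def)
    ultimately show ?case using r by auto
  next
    case (eng h1 h2)
    then obtain f1 f2 where f: "f1 \<in> loops X b" "h1 = loop_class X f1" "path_class X \<epsilon> f1 = eps_class X \<epsilon> [b]"
      "f2 \<in> loops X b" "h2 = loop_class X f2" "path_class X \<epsilon> f2 = eps_class X \<epsilon> [b]" by blast
    have "path_class X \<epsilon> (f1 +++ f2) = eps_class X \<epsilon> ([b] @ tl [b])"
      using f by (intro path_class_join \<epsilon>) (auto simp: loops_def)
    then show ?case using f join by (auto simp: mult_fundamental_group)
  qed
  then obtain f where f: "f \<in> loops X b" "loop_class X g = loop_class X f" "path_class X \<epsilon> f = eps_class X \<epsilon> [b]"
    by blast
  then show ?thesis
    using path_class_homotopic_paths[OF _ \<epsilon>] loop_class_eq_iff[OF g] by metis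
qed

section \<open>Lifting to the cover determined by small loops\<close>

lemma path_affine:
  assumes "path g" "path_image g \<subseteq> S" "\<And>t. t \<in> {0..1} \<Longrightarrow> u + v * t \<in> {0..1::real}"
  shows "path (\<lambda>t. g (u + v * t)) \<and> path_image (\<lambda>t. g (u + v * t)) \<subseteq> S"
proof
  show "path (\<lambda>t. g (u + v * t))"
    unfolding path_def by (rule continuous_on_compose2[OF assms(1)[unfolded path_def]])
      (use assms(3) in \<open>auto intro!: continuous_intros\<close>)
  show "path_image (\<lambda>t. g (u + v * t)) \<subseteq> S"
    using assms(2,3) by (auto simp: path_image_def image_subset_iff)
qed

text \<open>Near a parameter \<open>s\<close> each lift stays in one sheet, \<open>u\<close> or
  \<open>u'\<close>. The lifts agree at a nearby parameter exactly when these sheets coincide, so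
  the truth value of agreement is locally constant on the connected interval.\<close>

lemma covering_space_path_lift_unique:
  assumes cov: "covering_space E p X"
    and c: "path c" "path_image c \<subseteq> E" and c': "path c'" "path_image c' \<subseteq> E"
    and p: "\<And>t. t \<in> {0..1} \<Longrightarrow> p (c t) = p (c' t)" and start: "pathstart c = pathstart c'"
    and t: "t \<in> {0..1}"
  shows "c t = c' t"
proof -
  have "(c 0 = c' 0) = (c t = c' t)"
  proof (rule connected_equivalence_relation[where S = "{0..1::real}" and R = "\<lambda>s t. (c s = c' s) = (c t = c' t)"])
    fix s :: real assume s: "s \<in> {0..1}"
    then have cs: "c s \<in> E" "c' s \<in> E" using c c' by (auto simp: path_image_def)
    then have "p (c s) \<in> X" using covering_space_imp_surjective[OF cov] by auto
    then obtain T v where T: "p (c s) \<in> T" "\<Union>v = E \<inter> p -` T" "\<forall>u\<in>v. openin (top_of_set E) u"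
      "pairwise disjnt v" "\<forall>u\<in>v. \<exists>q. homeomorphism u T p q"
      using cov unfolding covering_space_def by metis
    have "c s \<in> \<Union>v" "c' s \<in> \<Union>v" unfolding T(2) using T(1) cs p[OF s] by auto
    then obtain u u' where u: "u \<in> v" "c s \<in> u" "u' \<in> v" "c' s \<in> u'" by blast
    have inj: "inj_on p u" if "u \<in> v" for u
      using T(5) that unfolding homeomorphism_def by (metis inj_on_inverseI)
    have eq: "c r = c' r \<longleftrightarrow> u = u'" if "c r \<in> u" "c' r \<in> u'" "r \<in> {0..1}" for r
    proof
      assume "c r = c' r"
      then have "\<not> disjnt u u'" using that by (auto simp: disjnt_def)
      then show "u = u'" using T(4) u by (auto simp: pairwise_def)
    next
      assume "u = u'"
      then show "c r = c' r" using inj_onD[OF inj[OF u(1)] p[OF that(3)]] that by simp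
    qed
    have "openin (top_of_set {0..1}) ({0..1} \<inter> c -` u)" "openin (top_of_set {0..1}) ({0..1} \<inter> c' -` u')"
      using continuous_openin_preimage[of "{0..1}" c E] continuous_openin_preimage[of "{0..1}" c' E] c c' T(3) u
      by (auto simp: path_def path_image_def image_subset_iff_funcset)
    then have "openin (top_of_set {0..1}) (({0..1} \<inter> c -` u) \<inter> ({0..1} \<inter> c' -` u'))"
      by (rule openin_Int)
    moreover have "s \<in> ({0..1} \<inter> c -` u) \<inter> ({0..1} \<inter> c' -` u')" using s u by simp
    moreover have "\<forall>r\<in>({0..1} \<inter> c -` u) \<inter> ({0..1} \<inter> c' -` u'). (c s = c' s) = (c r = c' r)"
      using eq[of s] eq u s by auto
    ultimately show "\<exists>T. openin (top_of_set {0..1}) T \<and> s \<in> T \<and> (\<forall>r\<in>T. (c s = c' s) = (c r = c' r))"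
      by blast
  qed (use t in auto)
  then show ?thesis using start by (simp add: pathstart_def)
qed

locale small_loop_cover =
  fixes X :: "'a::metric_space set" and b :: 'a and \<epsilon> :: real
    and E :: "'e::topological_space set" and p :: "'e \<Rightarrow> 'a" and e :: 'e
  assumes geodesic: "geodesic_space X" and base: "b \<in> X" and eps_pos: "\<epsilon> > 0"
    and delta_cover: "delta_cover X b (3 * \<epsilon> / 2) E p e"
begin

lemma cover: "covering_space E p X" "connected E" "e \<in> E" "p e = b"
  using delta_cover by (auto simp: delta_cover_def)

lemma p_in: "y \<in> E \<Longrightarrow> p y \<in> X"
  using covering_space_imp_surjective[OF cover(1)] by auto

lemma path_p:
  assumes "path c" "path_image c \<subseteq> E"
  shows "path (p \<circ> c)" "path_image (p \<circ> c) \<subseteq> X"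
proof -
  show "path (p \<circ> c)"
    using assms covering_space_imp_continuous[OF cover(1)]
    by (intro path_continuous_image) (auto intro: continuous_on_subset)
  show "path_image (p \<circ> c) \<subseteq> X"
    using assms p_in by (auto simp: path_image_compose)
qed

lemmas lift_unique = covering_space_path_lift_unique[OF cover(1)]

text \<open>Shrinking a local homeomorphism gives arbitrarily small sheets over metric balls about
  \<open>p y\<close>. Balls are the right base sets because geodesics issuing from the centre stay
  inside them.\<close>

lemma local_sheet:
  assumes "openin (top_of_set E) W" "y \<in> W"
  obtains U q r where "r > 0" "openin (top_of_set E) U" "y \<in> U" "U \<subseteq> W"
    "homeomorphism U (ball (p y) r \<inter> X) p q"
proof -
  have "y \<in> E" using assms openin_imp_subset by blast
  then obtain T u q where T: "y \<in> T" "openin (top_of_set E) T" "p y \<in> u" "openin (top_of_set X) u"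
    "homeomorphism T u p q"
    using covering_space_local_homeomorphism[OF cover(1)] by metis
  have TW: "openin (top_of_set E) (T \<inter> W)" using T(2) assms(1) by (rule openin_Int)
  then have "openin (top_of_set T) (T \<inter> W)"
    using T(2) by (meson inf_le1 openin_imp_subset openin_subset_trans)
  then have "openin (top_of_set u) (p ` (T \<inter> W))"
    using homeomorphism_imp_open_map[OF T(5)] by blast
  then have "openin (top_of_set X) (p ` (T \<inter> W))" using T(4) openin_trans by blast
  then obtain r where r: "r > 0" "ball (p y) r \<inter> X \<subseteq> p ` (T \<inter> W)"
    using T(1) assms(2) unfolding openin_contains_ball by blast
  have hom: "q (p z) = z" if "z \<in> T" for z using T(5) that by (auto simp: homeomorphism_def)
  define U where "U = (T \<inter> W) \<inter> (E \<inter> p -` ball (p y) r)"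
  have "openin (top_of_set E) (E \<inter> p -` ball (p y) r)"
    using covering_space_imp_continuous[OF cover(1)] by (simp add: continuous_openin_preimage_gen)
  then have op: "openin (top_of_set E) U" unfolding U_def by (rule openin_Int[OF TW])
  have "p ` U = ball (p y) r \<inter> X"
  proof
    show "p ` U \<subseteq> ball (p y) r \<inter> X" using p_in by (auto simp: U_def)
    show "ball (p y) r \<inter> X \<subseteq> p ` U"
    proof
      fix x assume x: "x \<in> ball (p y) r \<inter> X"
      then obtain z where z: "z \<in> T \<inter> W" "x = p z" using r by blast
      moreover have "z \<in> E" using z TW openin_imp_subset by blast
      ultimately show "x \<in> p ` U" using x by (auto simp: U_def)
    qed
  qed
  moreover have "q ` p ` U = U" using hom by (force simp: U_def)
  ultimately have "homeomorphism U (ball (p y) r \<inter> X) p q"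
    by (intro homeomorphism_of_subsets[OF T(5), of U "{}"]) (auto simp: U_def)
  moreover have "y \<in> U" using T(1) assms(2) \<open>y \<in> E\<close> r(1) by (simp add: U_def)
  ultimately show ?thesis using that[OF r(1) op] by (auto simp: U_def)
qed

text \<open>A geodesic from the centre \<open>p y\<close> to \<open>p z\<close> never gets farther
  from the centre than \<open>p z\<close>, so it stays in the ball; the inverse \<open>q\<close>
  lifts it without changing its length.\<close>

lemma sheet_geodesic:
  assumes "y \<in> U" "z \<in> U" "homeomorphism U (ball (p y) r \<inter> X) p q" "U \<subseteq> E"
  obtains c where "path c" "path_image c \<subseteq> U" "pathstart c = y" "pathfinish c = z"
    "path_length (p \<circ> c) = ennreal (dist (p y) (p z))"
proof -
  have "p ` U = ball (p y) r \<inter> X" "\<forall>z\<in>U. q (p z) = z"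
    using assms(3) by (auto simp: homeomorphism_def)
  then have pz: "p z \<in> ball (p y) r \<inter> X" "p y \<in> X" "q (p y) = y" "q (p z) = z"
    using assms p_in by blast+
  have "p z \<in> X" using pz(1) by simp
  then obtain g where g: "path g" "path_image g \<subseteq> X" "pathstart g = p y" "pathfinish g = p z"
    and len: "path_length g = ennreal (dist (p y) (p z))"
    "\<And>t. t \<in> {0..1} \<Longrightarrow> dist (p y) (g t) + dist (g t) (p z) \<le> dist (p y) (p z)"
    and g': "\<And>s t. s \<in> {0..1} \<Longrightarrow> t \<in> {0..1} \<Longrightarrow> dist (g s) (g t) \<le> dist (p y) (p z)"
    by (rule geodesic_spaceE[OF geodesic pz(2)]) (rule that)
  have d: "dist (p y) (g t) \<le> dist (p y) (p z)" if "t \<in> {0..1}" for t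
    using g'[of 0 t] g(3) that by (simp add: pathstart_def)
  have gb: "path_image g \<subseteq> ball (p y) r \<inter> X"
    using d g(2) pz(1) by (fastforce simp: path_image_def)
  have q: "continuous_on (ball (p y) r \<inter> X) q" "q ` (ball (p y) r \<inter> X) = U"
    "\<And>x. x \<in> ball (p y) r \<inter> X \<Longrightarrow> p (q x) = x"
    using assms(3) by (auto simp: homeomorphism_def)
  show ?thesis
  proof
    show "path (q \<circ> g)" using g(1) q(1) gb by (intro path_continuous_image) (auto intro: continuous_on_subset)
    show "path_image (q \<circ> g) \<subseteq> U" using gb q(2) by (auto simp: path_image_compose)
    show "pathstart (q \<circ> g) = y" "pathfinish (q \<circ> g) = z"
      using g pz by (simp_all add: pathstart_compose pathfinish_compose)
    have "p (q (g t)) = g t" if "t \<in> {0..1}" for t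
      by (rule q(3)) (use gb that in \<open>unfold path_image_def, blast\<close>)
    then show "path_length (p \<circ> (q \<circ> g)) = ennreal (dist (p y) (p z))"
      unfolding len(1)[symmetric] by (intro path_length_cong) simp
  qed
qed

text \<open>Being joined by a path is an equivalence relation, and each point is joined to its whole
  sheet by lifted geodesics; connectedness of \<open>E\<close> does the rest.\<close>

lemma path_connected_cover:
  assumes "y \<in> E" "z \<in> E"
  obtains c where "path c" "path_image c \<subseteq> E" "pathstart c = y" "pathfinish c = z"
proof -
  have "\<exists>c. path c \<and> path_image c \<subseteq> E \<and> pathstart c = y \<and> pathfinish c = z"
  proof (rule connected_equivalence_relation[OF cover(2) assms])
    fix x y assume "\<exists>c. path c \<and> path_image c \<subseteq> E \<and> pathstart c = x \<and> pathfinish c = y"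
    then show "\<exists>c. path c \<and> path_image c \<subseteq> E \<and> pathstart c = y \<and> pathfinish c = x"
      by (metis path_reversepath path_image_reversepath pathstart_reversepath pathfinish_reversepath)
  next
    fix x y z assume "\<exists>c. path c \<and> path_image c \<subseteq> E \<and> pathstart c = x \<and> pathfinish c = y"
      "\<exists>c. path c \<and> path_image c \<subseteq> E \<and> pathstart c = y \<and> pathfinish c = z"
    then show "\<exists>c. path c \<and> path_image c \<subseteq> E \<and> pathstart c = x \<and> pathfinish c = z"
      by (metis path_join pathstart_join pathfinish_join subset_path_image_join)
  next
    fix y assume "y \<in> E"
    obtain U q r where U: "openin (top_of_set E) U" "y \<in> U" "homeomorphism U (ball (p y) r \<inter> X) p q"
      by (rule local_sheet[OF openin_subtopology_self \<open>y \<in> E\<close>])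
    then have "U \<subseteq> E" using openin_imp_subset by blast
    then have "\<exists>c. path c \<and> path_image c \<subseteq> E \<and> pathstart c = y \<and> pathfinish c = z" if "z \<in> U" for z
      using sheet_geodesic[OF U(2) that U(3)] by (metis subset_trans)
    then show "\<exists>T. openin (top_of_set E) T \<and> y \<in> T \<and>
        (\<forall>z\<in>T. \<exists>c. path c \<and> path_image c \<subseteq> E \<and> pathstart c = y \<and> pathfinish c = z)"
      using U by blast
  qed
  then show ?thesis using that by blast
qed

text \<open>Conjugated by the image of a path from \<open>e\<close> to \<open>y\<close>, the loop \<open>L\<close> lifts to a loop at \<open>e\<close>.\<close>

lemma small_loop_lift:
  assumes y: "y \<in> E" and L: "L \<in> loops X (p y)" and x: "x \<in> X" "path_image L \<subseteq> ball x (3 * \<epsilon> / 2)"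
  obtains L' where "L' \<in> loops E y" "\<And>t. t \<in> {0..1} \<Longrightarrow> p (L' t) = L t"
proof -
  obtain c where c: "path c" "path_image c \<subseteq> E" "pathstart c = e" "pathfinish c = y"
    using path_connected_cover[OF cover(3) y] by blast
  have L': "path L" "path_image L \<subseteq> X" "pathstart L = p y" "pathfinish L = p y"
    using L by (auto simp: loops_def)
  let ?c = "p \<circ> c"
  have pc: "path ?c" "path_image ?c \<subseteq> X" "pathstart ?c = b" "pathfinish ?c = p y"
    using path_p c cover(4) by (auto simp: pathstart_compose pathfinish_compose)
  let ?g = "?c +++ L +++ reversepath ?c"
  have g: "?g \<in> loops X b" using pc L' by (auto simp: loops_def subset_path_image_join)
  have "loop_class X ?g \<in> small_loop_classes X b (3 * \<epsilon> / 2)"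
    unfolding small_loop_classes_def
    by (intro CollectI exI[of _ "?c"] exI[of _ L] conjI bexI[of _ x] refl) (use pc L x in auto)
  then have "loop_class X ?g \<in> small_loop_subgroup X b (3 * \<epsilon> / 2)"
    unfolding small_loop_subgroup_def by (rule generate.incl)
  then obtain g' where g': "g' \<in> loops E e" "\<And>t. t \<in> {0..1} \<Longrightarrow> p (g' t) = ?g t"
    using delta_cover g unfolding delta_cover_def by blast
  have g'E: "path g'" "path_image g' \<subseteq> E" "g' 0 = e" "g' 1 = e"
    using g'(1) by (auto simp: loops_def pathstart_def pathfinish_def)
  \<comment> \<open>The triple join runs through \<open>?c\<close> on \<open>[0, 1/2]\<close>,
    through \<open>L\<close> on \<open>[1/2, 3/4]\<close> and back through \<open>?c\<close> on
    \<open>[3/4, 1]\<close>. Uniqueness of lifts identifies the first piece with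
    \<open>c\<close>.\<close>
  have "g' (0 + 1/2 * t) = c t" if "t \<in> {0..1}" for t
  proof (rule lift_unique[OF _ _ c(1,2) _ _ that])
    show "p (g' (0 + 1/2 * t)) = p (c t)" if "t \<in> {0..1}" for t
      using that g'(2)[of "1/2 * t"] by (auto simp: joinpaths_def)
  qed (use path_affine[OF g'E(1,2), of 0 "1/2"] g'E(3) c(3) in \<open>auto simp: pathstart_def\<close>)
  from this[of 1] have half: "g' (1/2) = y" using c(4) by (simp add: pathfinish_def)
  \<comment> \<open>The last quarter, read backwards from the closing point \<open>e\<close>, is
    again a lift of \<open>?c\<close> from \<open>e\<close>. So the middle piece begins and ends at
    \<open>y\<close>.\<close>
  have "g' (1 + (-1/4) * t) = c t" if "t \<in> {0..1}" for t
  proof (rule lift_unique[OF _ _ c(1,2) _ _ that])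
    show "p (g' (1 + (-1/4) * t)) = p (c t)" if "t \<in> {0..1}" for t
      using that g'(2)[of "1 + (-1/4) * t"] pc(4) L'(4) 
      by (auto simp: joinpaths_def reversepath_def pathfinish_def)
  qed (use path_affine[OF g'E(1,2), of 1 "-1/4"] g'E(4) c(3) in \<open>auto simp: pathstart_def\<close>)
  from this[of 1] have quarter: "g' (3/4) = y" using c(4) by (simp add: pathfinish_def)
  show ?thesis
  proof
    show "(\<lambda>t. g' (1/2 + 1/4 * t)) \<in> loops E y"
      using path_affine[OF g'E(1,2), of "1/2" "1/4"] half quarter
      by (auto simp: loops_def pathstart_def pathfinish_def)
    show "p (g' (1/2 + 1/4 * t)) = L t" if "t \<in> {0..1}" for t
      using that g'(2)[of "1/2 + 1/4 * t"] pc(4) L'(3)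
      by (auto simp: joinpaths_def pathfinish_def pathstart_def)
  qed
qed

text \<open>The loop that runs along \<open>g\<close> and back stays in the ball, so it lifts; the
  first half of its lift is the required path.\<close>

lemma small_path_lift:
  assumes y: "y \<in> E" and g: "path g" "path_image g \<subseteq> X" "pathstart g = p y"
    and x: "x \<in> X" "path_image g \<subseteq> ball x (3 * \<epsilon> / 2)"
  obtains c where "path c" "path_image c \<subseteq> E" "pathstart c = y" "\<And>t. t \<in> {0..1} \<Longrightarrow> p (c t) = g t"
proof -
  have "g +++ reversepath g \<in> loops X (p y)" using g by (auto simp: loops_def subset_path_image_join)
  moreover have "path_image (g +++ reversepath g) \<subseteq> ball x (3 * \<epsilon> / 2)"
    using x by (simp add: subset_path_image_join)
  ultimately obtain L where L: "L \<in> loops E y" "\<And>t. t \<in> {0..1} \<Longrightarrow> p (L t) = (g +++ reversepath g) t"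
    using small_loop_lift[OF y _ x(1)] by blast
  then have L': "path L" "path_image L \<subseteq> E" "L 0 = y" by (auto simp: loops_def pathstart_def)
  show ?thesis
  proof
    show "path (\<lambda>t. L (0 + 1/2 * t))" "path_image (\<lambda>t. L (0 + 1/2 * t)) \<subseteq> E"
      using path_affine[OF L'(1,2), of 0 "1/2"] by auto
    show "p (L (0 + 1/2 * t)) = g t" if "t \<in> {0..1}" for t
      using that L(2)[of "1/2 * t"] by (auto simp: joinpaths_def)
  qed (use L'(3) in \<open>simp add: pathstart_def\<close>)
qed

text \<open>Going out along \<open>p \<circ> c\<close> and back along \<open>p \<circ> c'\<close> is
  a small loop, so its lift closes up. By uniqueness \<open>c\<close> and \<open>c'\<close> are its
  two halves, and they meet at the midpoint.\<close>

lemma small_path_lift_finish: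
  assumes c: "path c" "path_image c \<subseteq> E" and c': "path c'" "path_image c' \<subseteq> E"
    and x: "x \<in> X" "p ` path_image c \<subseteq> ball x (3 * \<epsilon> / 2)" "p ` path_image c' \<subseteq> ball x (3 * \<epsilon> / 2)"
    and "pathstart c = pathstart c'" "p (pathfinish c) = p (pathfinish c')"
  shows "pathfinish c = pathfinish c'"
proof -
  let ?g = "(p \<circ> c) +++ reversepath (p \<circ> c')" and ?y = "pathstart c"
  have y: "?y \<in> E" by (rule subsetD[OF c(2) pathstart_in_path_image])
  have g: "?g \<in> loops X (p ?y)"
    using path_p[OF c] path_p[OF c'] assms(9)
    by (simp add: loops_def subset_path_image_join pathstart_compose pathfinish_compose assms(8)[symmetric])
  have gx: "path_image ?g \<subseteq> ball x (3 * \<epsilon> / 2)"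
    using x(2,3) by (simp add: subset_path_image_join path_image_compose)
  obtain L where L: "L \<in> loops E ?y" "\<And>t. t \<in> {0..1} \<Longrightarrow> p (L t) = ?g t"
    by (rule small_loop_lift[OF y g x(1) gx]) blast
  then have L': "path L" "path_image L \<subseteq> E" "L 0 = ?y" "L 1 = ?y"
    by (auto simp: loops_def pathstart_def pathfinish_def)
  have 1: "L (0 + 1/2 * t) = c t" if "t \<in> {0..1}" for t
  proof (rule lift_unique[OF _ _ c _ _ that])
    show "p (L (0 + 1/2 * t)) = p (c t)" if "t \<in> {0..1}" for t
      using that L(2)[of "1/2 * t"] by (auto simp: joinpaths_def)
  qed (use path_affine[OF L'(1,2), of 0 "1/2"] L'(3) in \<open>auto simp: pathstart_def\<close>)
  have 2: "L (1 + (-1/2) * t) = c' t" if "t \<in> {0..1}" for t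
  proof (rule lift_unique[OF _ _ c' _ _ that])
    show "p (L (1 + (-1/2) * t)) = p (c' t)" if "t \<in> {0..1}" for t
      using that L(2)[of "1 + (-1/2) * t"] assms(9)
      by (auto simp: joinpaths_def reversepath_def pathfinish_def)
    show "path (\<lambda>t. L (1 + (-1/2) * t))" "path_image (\<lambda>t. L (1 + (-1/2) * t)) \<subseteq> E"
      using path_affine[OF L'(1,2), of 1 "-1/2"] by auto
    show "pathstart (\<lambda>t. L (1 + (-1/2) * t)) = pathstart c'"
      using L'(4) assms(8) by (simp add: pathstart_def)
  qed
  show ?thesis using 1[of 1] 2[of 1] by (simp add: pathfinish_def)
qed

section \<open>Transport along chains\<close>

text \<open>The value of \<open>tr\<close> is only meaningful if \<open>x\<close> lies in the ball of radius \<open>3 * \<epsilon> / 2\<close> about \<open>p y\<close>.\<close>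

definition tr :: "'e \<Rightarrow> 'a \<Rightarrow> 'e" where
  "tr y x = (THE z. \<exists>c. path c \<and> path_image c \<subseteq> E \<and> pathstart c = y \<and> pathfinish c = z \<and>
     p z = x \<and> p ` path_image c \<subseteq> ball (p y) (3 * \<epsilon> / 2))"

text \<open>Any path over the ball computes \<open>tr\<close>, not only a lifted geodesic. This
  covers both two consecutive sides of a triangle and short pieces of an arbitrary path.\<close>

lemma tr_eq:
  assumes "path c" "path_image c \<subseteq> E" "pathstart c = y" "p ` path_image c \<subseteq> ball (p y) (3 * \<epsilon> / 2)"
  shows "tr y (p (pathfinish c)) = pathfinish c"
  unfolding tr_def
proof (rule the_equality)
  show "\<exists>c'. path c' \<and> path_image c' \<subseteq> E \<and> pathstart c' = y \<and> pathfinish c' = pathfinish c \<and>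
      p (pathfinish c) = p (pathfinish c) \<and> p ` path_image c' \<subseteq> ball (p y) (3 * \<epsilon> / 2)"
    using assms by (intro exI[of _ c]) simp
next
  have y: "p y \<in> X" using p_in subsetD[OF assms(2) pathstart_in_path_image] assms(3) by simp
  fix z assume "\<exists>c'. path c' \<and> path_image c' \<subseteq> E \<and> pathstart c' = y \<and> pathfinish c' = z \<and>
      p z = p (pathfinish c) \<and> p ` path_image c' \<subseteq> ball (p y) (3 * \<epsilon> / 2)"
  then obtain c' where c': "path c'" "path_image c' \<subseteq> E" "pathstart c' = y" "pathfinish c' = z"
      "p z = p (pathfinish c)" "p ` path_image c' \<subseteq> ball (p y) (3 * \<epsilon> / 2)" by (elim exE conjE)
  show "z = pathfinish c"
    using small_path_lift_finish[OF c'(1,2) assms(1,2) y c'(6) assms(4)] c' assms(3) by simp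
qed

lemma trE:
  assumes "y \<in> E" "x \<in> X" "dist (p y) x < \<epsilon>"
  obtains c where "path c" "path_image c \<subseteq> E" "pathstart c = y" "pathfinish c = tr y x" "p (tr y x) = x"
    "path_length (p \<circ> c) = ennreal (dist (p y) x)"
    "\<And>t. t \<in> {0..1} \<Longrightarrow> dist (p y) (p (c t)) + dist (p (c t)) x \<le> dist (p y) x"
    "\<And>s t. s \<in> {0..1} \<Longrightarrow> t \<in> {0..1} \<Longrightarrow> dist (p (c s)) (p (c t)) \<le> dist (p y) x"
proof -
  obtain g where g: "path g" "path_image g \<subseteq> X" "pathstart g = p y" "pathfinish g = x"
    "path_length g = ennreal (dist (p y) x)"
    and g1: "\<And>t. t \<in> {0..1} \<Longrightarrow> dist (p y) (g t) + dist (g t) x \<le> dist (p y) x"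
    and g2: "\<And>s t. s \<in> {0..1} \<Longrightarrow> t \<in> {0..1} \<Longrightarrow> dist (g s) (g t) \<le> dist (p y) x"
    by (rule geodesic_spaceE[OF geodesic p_in[OF assms(1)] assms(2)]) (rule that)
  have gb: "g t \<in> ball (p y) (3 * \<epsilon> / 2)" if "t \<in> {0..1}" for t
    using g1[OF that] assms(3) eps_pos zero_le_dist[of "g t" x] unfolding mem_ball by linarith
  then have "path_image g \<subseteq> ball (p y) (3 * \<epsilon> / 2)" unfolding path_image_def by blast
  then obtain c where c: "path c" "path_image c \<subseteq> E" "pathstart c = y" 
    and pc: "\<And>t. t \<in> {0..1} \<Longrightarrow> p (c t) = g t"
    by (rule small_path_lift[OF assms(1) g(1-3) p_in[OF assms(1)]]) (rule that)
  have fin: "p (pathfinish c) = x" using pc[of 1] g(4) by (simp add: pathfinish_def)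
  have "p ` path_image c \<subseteq> ball (p y) (3 * \<epsilon> / 2)"
    unfolding path_image_def image_image using gb pc by (simp add: image_subset_iff)
  then have tr: "pathfinish c = tr y x" using tr_eq[OF c] fin by simp
  show ?thesis
  proof (rule that[OF c tr])
    show "p (tr y x) = x" using fin tr by simp
    show "path_length (p \<circ> c) = ennreal (dist (p y) x)"
      unfolding g(5)[symmetric] using pc by (intro path_length_cong) simp
  qed (use g1 g2 pc in simp_all)
qed

lemma tr_in: 
  assumes "y \<in> E" "x \<in> X" "dist (p y) x < \<epsilon>"
  shows "tr y x \<in> E" "p (tr y x) = x"
proof -
  obtain c where c: "path_image c \<subseteq> E" "pathfinish c = tr y x" "p (tr y x) = x"
    by (rule trE[OF assms]) (rule that)
  then show "tr y x \<in> E" "p (tr y x) = x" using subsetD[OF c(1) pathfinish_in_path_image] by simp_all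
qed

lemma tr_self [simp]: "y \<in> E \<Longrightarrow> tr y (p y) = y"
  using tr_eq[of "\<lambda>_. y" y] eps_pos
  by (auto simp: path_def path_image_def pathstart_def pathfinish_def)

text \<open>A triangle with sides shorter than \<open>\<epsilon>\<close> has perimeter less than \<open>3 * \<epsilon>\<close>, so it lies in the ball
  of radius \<open>3 * \<epsilon> / 2\<close> about any of its vertices.\<close>

lemma tr_tr:
  assumes "y \<in> E" "x \<in> X" "x' \<in> X" "dist (p y) x < \<epsilon>" "dist x x' < \<epsilon>" "dist (p y) x' < \<epsilon>"
  shows "tr (tr y x) x' = tr y x'"
proof -
  obtain c where c: "path c" "path_image c \<subseteq> E" "pathstart c = y" "pathfinish c = tr y x" "p (tr y x) = x"
    "path_length (p \<circ> c) = ennreal (dist (p y) x)"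
    and c1: "\<And>t. t \<in> {0..1} \<Longrightarrow> dist (p y) (p (c t)) + dist (p (c t)) x \<le> dist (p y) x"
    and c2: "\<And>s t. s \<in> {0..1} \<Longrightarrow> t \<in> {0..1} \<Longrightarrow> dist (p (c s)) (p (c t)) \<le> dist (p y) x"
    by (rule trE[OF assms(1,2,4)]) (rule that)
  have z: "tr y x \<in> E" "p (tr y x) = x" by (rule tr_in[OF assms(1,2,4)])+
  with assms(5) have "dist (p (tr y x)) x' < \<epsilon>" by simp
  then obtain c' where c': "path c'" "path_image c' \<subseteq> E" "pathstart c' = tr y x" "pathfinish c' = tr (tr y x) x'" 
    "p (tr (tr y x) x') = x'"
    "path_length (p \<circ> c') = ennreal (dist (p (tr y x)) x')"
    and c1': "\<And>t. t \<in> {0..1} \<Longrightarrow> dist (p (tr y x)) (p (c' t)) + dist (p (c' t)) x' \<le> dist (p (tr y x)) x'"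
    and c2': "\<And>s t. s \<in> {0..1} \<Longrightarrow> t \<in> {0..1} \<Longrightarrow> dist (p (c' s)) (p (c' t)) \<le> dist (p (tr y x)) x'"
    by (rule trE[OF z(1) assms(3)]) (rule that)
  have "dist (p y) (p (c t)) < 3 * \<epsilon> / 2" if "t \<in> {0..1}" for t
    using c1[OF that] assms(4) eps_pos zero_le_dist[of "p (c t)" x] by linarith
  \<comment> \<open>For \<open>m = p (c' t)\<close> on the side opposite \<open>p y\<close>, adding
    the triangle inequalities through \<open>x\<close> and through \<open>x'\<close> bounds twice
    the distance from \<open>p y\<close> to \<open>m\<close> by the perimeter.\<close>
  moreover have "dist (p y) (p (c' t)) < 3 * \<epsilon> / 2" if "t \<in> {0..1}" for t
    using c1'[OF that] assms(4-6) dist_triangle[of "p y" "p (c' t)" x] dist_triangle[of "p y" "p (c' t)" x']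
      dist_commute[of x' "p (c' t)"]
    unfolding z(2) by linarith
  ultimately have "p ` path_image c \<subseteq> ball (p y) (3 * \<epsilon> / 2)" "p ` path_image c' \<subseteq> ball (p y) (3 * \<epsilon> / 2)"
    by (auto simp: path_image_def)
  then have "p ` path_image (c +++ c') \<subseteq> ball (p y) (3 * \<epsilon> / 2)"
    using c(4) c'(3) by (simp add: path_image_join image_Un)
  from tr_eq[OF _ _ _ this] show ?thesis using c(1-4) c'(1-5) by (simp add: subset_path_image_join)
qed

text \<open>The starting point of the chain is processed too; it equals \<open>p y\<close>, so by
  \<open>tr_self\<close> this first step does nothing.\<close>

definition transport :: "'e \<Rightarrow> 'a list \<Rightarrow> 'e" where
  "transport y xs = fold (\<lambda>x y. tr y x) xs y"

lemma transport_simps [simp]: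
  "transport y [] = y" "transport y (x # xs) = transport (tr y x) xs"
  "transport y (xs @ ys) = transport (transport y xs) ys"
  by (simp_all add: transport_def)

text \<open>The path is the broken geodesic over the chain, lifted edge by edge. Its length bound
  serves the isometry, and its class serves injectivity.\<close>

lemma transport_lift:
  assumes "eps_chain X \<epsilon> xs" "hd xs = p y" "y \<in> E"
  shows "p (transport y xs) = last xs \<and> (\<exists>c. path c \<and> path_image c \<subseteq> E \<and> pathstart c = y \<and> pathfinish c = transport y xs \<and>
    path_length (p \<circ> c) \<le> ennreal (chain_length xs) \<and> path_class X \<epsilon> (p \<circ> c) = eps_class X \<epsilon> xs)"
  using assms(1,2)
proof (induction xs rule: rev_induct)
  case Nil
  then show ?case by (simp add: eps_chain_def)
next
  case (snoc x xs)
  show ?case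
  proof (cases "xs = []")
    case True
    then have x: "x = p y" using snoc.prems by simp
    let ?c = "\<lambda>_::real. y"
    have "chain_length (map (\<lambda>_. p y) ts) = 0" for ts :: "real list"
      unfolding chain_length_def by (rule sum.neutral) auto
    then have "path_length (p \<circ> ?c) \<le> ennreal (chain_length [x])"
      unfolding path_length_def by (intro SUP_least) (simp add: o_def)
    moreover have "path_class X \<epsilon> (p \<circ> ?c) = eps_class X \<epsilon> [x]"
      using path_class_const[OF geodesic eps_pos p_in[OF assms(3)]] x by (simp add: o_def)
    ultimately show ?thesis using assms(3) True x
      by (intro conjI exI[of _ ?c]) (auto simp: path_def path_image_def pathstart_def pathfinish_def)
  next
    case False
    define z where "z = transport y xs"
    have ch: "eps_chain X \<epsilon> xs" "hd xs = p y" "x \<in> X" "dist (last xs) x < \<epsilon>"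
      using snoc.prems False by (auto simp: eps_chain_append eps_chain_def[of X \<epsilon> "[x]"])
    then obtain c where c: "p z = last xs" "path c" "path_image c \<subseteq> E" "pathstart c = y" "pathfinish c = z"
      "path_length (p \<circ> c) \<le> ennreal (chain_length xs)" "path_class X \<epsilon> (p \<circ> c) = eps_class X \<epsilon> xs"
      using snoc.IH unfolding z_def by blast
    have z: "z \<in> E" using subsetD[OF c(3) pathfinish_in_path_image] c(5) by simp
    have zx: "dist (p z) x < \<epsilon>" using ch(4) c(1) by simp
    obtain c' where c': "path c'" "path_image c' \<subseteq> E" "pathstart c' = z" "pathfinish c' = tr z x" "p (tr z x) = x"
      "path_length (p \<circ> c') = ennreal (dist (p z) x)"
      and c'': "\<And>t. t \<in> {0..1} \<Longrightarrow> dist (p z) (p (c' t)) + dist (p (c' t)) x \<le> dist (p z) x"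
        "\<And>s t. s \<in> {0..1} \<Longrightarrow> t \<in> {0..1} \<Longrightarrow> dist (p (c' s)) (p (c' t)) \<le> dist (p z) x"
      by (rule trE[OF z ch(3) zx]) (rule that)
    have join: "p \<circ> (c +++ c') = (p \<circ> c) +++ (p \<circ> c')" by (auto simp: joinpaths_def)
    have fin: "pathfinish (p \<circ> c) = pathstart (p \<circ> c')"
      using c(5) c'(3) by (simp add: pathfinish_compose pathstart_compose)
    have "path_length (p \<circ> (c +++ c')) \<le> ennreal (chain_length xs) + ennreal (dist (p z) x)"
      unfolding join using path_length_join[OF fin] c(6) c'(6) by (metis add_right_mono order_trans)
    also have "\<dots> = ennreal (chain_length (xs @ [x]))"
      using False c(1) by (simp add: chain_length_append ennreal_plus)
    finally have 1: "path_length (p \<circ> (c +++ c')) \<le> ennreal (chain_length (xs @ [x]))" .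
    \<comment> \<open>The lifted edge projects to a geodesic of diameter less than
      \<open>\<epsilon>\<close>, so its two endpoints already form a fine sample.\<close>
    have "path_class X \<epsilon> (p \<circ> c') = eps_class X \<epsilon> [pathstart (p \<circ> c'), pathfinish (p \<circ> c')]"
      by (rule path_class_short[OF path_p(2)[OF c'(1,2)]]) (use c''(2) zx in fastforce)
    also have "\<dots> = eps_class X \<epsilon> [p z, x]"
      using c' by (simp add: pathstart_compose pathfinish_compose)
    finally have "path_class X \<epsilon> (p \<circ> (c +++ c')) = eps_class X \<epsilon> (xs @ tl [p z, x])"
      unfolding join by (intro path_class_join path_p c(2,3,7) c'(1,2) fin eps_pos)
    then have 2: "path_class X \<epsilon> (p \<circ> (c +++ c')) = eps_class X \<epsilon> (xs @ [x])" by simp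
    show ?thesis
    proof (intro conjI exI[of _ "c +++ c'"])
      show "path_length (p \<circ> (c +++ c')) \<le> ennreal (chain_length (xs @ [x]))" by (rule 1)
      show "path_class X \<epsilon> (p \<circ> (c +++ c')) = eps_class X \<epsilon> (xs @ [x])" by (rule 2)
    qed (use c(2-5) c'(1-5) z_def in \<open>simp_all add: subset_path_image_join\<close>)
  qed
qed

lemma transport_in:
  assumes "eps_chain X \<epsilon> xs" "hd xs = p y" "y \<in> E"
  shows "transport y xs \<in> E" "p (transport y xs) = last xs"
proof -
  obtain c where "path_image c \<subseteq> E" "pathfinish c = transport y xs"
    using transport_lift[OF assms] by blast
  then show "transport y xs \<in> E" using pathfinish_in_path_image[of c] by auto
  show "p (transport y xs) = last xs" using transport_lift[OF assms] by blast
qed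

text \<open>Between consecutive sample times \<open>c\<close> itself stays over the ball about the
  image of its current point, so by \<open>tr_eq\<close> each transport step follows
  \<open>c\<close>.\<close>

lemma transport_path:
  assumes c: "path c" "path_image c \<subseteq> E" and fine: "fine_mesh \<epsilon> (p \<circ> c) n"
  shows "transport (pathstart c) (path_chain (p \<circ> c) n) = pathfinish c"
proof -
  have n: "n > 0" using fine by (rule fine_mesh_pos)
  have "transport (pathstart c) (map (\<lambda>i. (p \<circ> c) (real i / real n)) [0..<Suc k]) = c (real k / real n)" if "k \<le> n" for k
    using that
  proof (induction k)
    case 0
    have "c 0 \<in> E" using c(2) by (auto simp: path_image_def)
    then show ?case by (simp add: pathstart_def)
  next
    case (Suc k)
    define s where "s = real k / real n"
    have s: "0 \<le> s" "s + 1 / real n \<le> 1" "real (Suc k) / real n = s + 1 / real n"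
      using Suc.prems n by (simp_all add: s_def field_simps)
    have I: "s + 1 / real n * t \<in> {0..1}" "\<bar>s - (s + 1 / real n * t)\<bar> \<le> 1 / real n" if "t \<in> {0..1}" for t
    proof -
      have "0 \<le> 1 / real n * t" "1 / real n * t \<le> 1 / real n"
        using that by (auto simp: divide_right_mono)
      then show "s + 1 / real n * t \<in> {0..1}" "\<bar>s - (s + 1 / real n * t)\<bar> \<le> 1 / real n" using s by auto
    qed
    let ?c = "\<lambda>t. c (s + 1 / real n * t)"
    have "dist (p (c s)) (p (?c t)) < 3 * \<epsilon> / 2" if "t \<in> {0..1}" for t
    proof -
      have "dist ((p \<circ> c) s) ((p \<circ> c) (s + 1 / real n * t)) < \<epsilon>"
        by (rule fine_meshD[OF fine]) (use I[OF that] I(1)[of 0] in auto)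
      then show ?thesis using eps_pos by simp
    qed
    then have "p ` path_image ?c \<subseteq> ball (p (c s)) (3 * \<epsilon> / 2)" by (auto simp: path_image_def)
    then have "tr (c s) (p (pathfinish ?c)) = pathfinish ?c"
      using path_affine[OF c, of s "1 / real n"] I(1) by (intro tr_eq) (auto simp: pathstart_def)
    then have "tr (c s) (p (c (s + 1 / real n))) = c (s + 1 / real n)" by (simp add: pathfinish_def)
    then show ?case using Suc.IH Suc.prems s(3) by (simp add: s_def)
  qed
  from this[of n] show ?thesis using n by (simp add: path_chain_def pathfinish_def)
qed

text \<open>An interior insertion replaces one side of a short triangle by the other two, which is
  \<open>tr_tr\<close>. An insertion at an end repeats the fixed endpoint, which is
  \<open>tr_self\<close>.\<close>

lemma transport_add_point:
  assumes "add_point X \<epsilon> us vs" "hd us = p y" "y \<in> E"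
  shows "transport y us = transport y vs"
proof -
  obtain as x bs where eq: "us = as @ bs" "vs = as @ x # bs"
    and ch: "eps_chain X \<epsilon> us" "eps_chain X \<epsilon> vs" "hd us = hd vs" "last us = last vs"
    using assms(1) by (auto simp: add_point_def)
  show ?thesis
  proof (cases "as = []")
    case True
    then have "x = p y" using ch(3) assms(2) eq by simp
    then show ?thesis using eq True assms(3) by simp
  next
    case False
    define w where "w = transport y as"
    have as: "eps_chain X \<epsilon> as" "hd as = p y"
      using ch(2,3) eq False assms(2) by (auto simp: eps_chain_append)
    then have w: "w \<in> E" "p w = last as" using transport_in[OF as assms(3)] by (auto simp: w_def)
    show ?thesis
    proof (cases bs)
      case Nil
      then have "x = p w" using ch(4) eq False w by simp
      then show ?thesis using eq Nil tr_self[OF w(1)] by (simp add: w_def[symmetric])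
    next
      case (Cons v bs')
      then have "dist (last as) x < \<epsilon>" "dist x v < \<epsilon>" "dist (last as) v < \<epsilon>" "x \<in> X" "v \<in> X"
        using ch(1,2) eq False by (auto simp: eps_chain_def successively_append_iff)
      then have "tr (tr w x) v = tr w v" using w by (intro tr_tr) auto
      then show ?thesis using eq Cons by (simp add: w_def[symmetric])
    qed
  qed
qed

lemma transport_homotopic:
  assumes "eps_homotopic X \<epsilon> xs ys" "eps_chain X \<epsilon> xs" "hd xs = p y" "y \<in> E"
  shows "transport y xs = transport y ys"
  using assms(1) unfolding eps_homotopic_def
proof (induction rule: rtranclp_induct)
  case (step us vs)
  then have "eps_homotopic X \<epsilon> xs us" by (simp add: eps_homotopic_def)
  then have "hd us = p y" using eps_homotopicD[OF _ assms(2)] assms(3) by metis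
  moreover then have "hd vs = p y" using step.hyps(2) by (auto simp: add_point_def)
  ultimately have "transport y us = transport y vs"
    using step.hyps(2) transport_add_point assms(4) by metis
  then show ?case using step.IH by simp
qed simp

text \<open>The lifts of two chains with the same transport form a loop in \<open>E\<close>, so the
  image loop has its class in the subgroup and is null as a chain. This uses the lifting criterion
  from lifts to the subgroup.\<close>

lemma transport_inj:
  assumes xs: "eps_chain X \<epsilon> xs" "hd xs = b" and ys: "eps_chain X \<epsilon> ys" "hd ys = b"
    and eq: "transport e xs = transport e ys"
  shows "eps_homotopic X \<epsilon> xs ys"
proof -
  obtain c where c: "path c" "path_image c \<subseteq> E" "pathstart c = e" "pathfinish c = transport e xs"
    "path_class X \<epsilon> (p \<circ> c) = eps_class X \<epsilon> xs"
    using transport_lift[OF xs(1) _ cover(3)] xs(2) cover(4) by metis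
  obtain c' where c': "path c'" "path_image c' \<subseteq> E" "pathstart c' = e" "pathfinish c' = transport e ys"
    "path_class X \<epsilon> (p \<circ> c') = eps_class X \<epsilon> ys"
    using transport_lift[OF ys(1) _ cover(3)] ys(2) cover(4) by metis
  have last: "last xs = last ys"
    using transport_in(2)[OF xs(1) _ cover(3)] transport_in(2)[OF ys(1) _ cover(3)] xs(2) ys(2) eq cover(4) by simp
  let ?g = "c +++ reversepath c'"
  have g: "?g \<in> loops E e" using c c' eq by (auto simp: loops_def subset_path_image_join)
  then have "p \<circ> ?g \<in> loops X b"
    using path_p[of ?g] cover(4) by (auto simp: loops_def pathstart_compose pathfinish_compose)
  moreover have "loop_class X (p \<circ> ?g) \<in> small_loop_subgroup X b (3 * \<epsilon> / 2)"
    using delta_cover g calculation unfolding delta_cover_def by (metis comp_apply)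
  ultimately have "path_class X \<epsilon> (p \<circ> ?g) = eps_class X \<epsilon> [b]"
    by (rule path_class_small_loop_subgroup[OF geodesic base eps_pos])
  moreover have "p \<circ> ?g = (p \<circ> c) +++ reversepath (p \<circ> c')"
    by (auto simp: joinpaths_def reversepath_def)
  moreover have "path_class X \<epsilon> ((p \<circ> c) +++ reversepath (p \<circ> c')) = eps_class X \<epsilon> (xs @ tl (rev ys))"
    using path_p[OF c(1,2)] path_p[OF c'(1,2)] c(4) c'(4) eq
    by (intro path_class_join path_class_reversepath c(5) c'(5) eps_pos)
      (auto simp: pathfinish_compose)
  ultimately have "eps_homotopic X \<epsilon> (xs @ tl (rev ys)) [b]" by (simp add: eps_class_eq_iff[symmetric])
  then show ?thesis
    using eps_homotopic_cancel_right[OF eps_pos xs(1) ys(1) _ last] xs(2) ys(2) by simp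
qed

lemma transport_glue:
  assumes "eps_chain X \<epsilon> xs" "hd xs = p y" "y \<in> E" "ys \<noteq> []" "last xs = hd ys"
  shows "transport y (xs @ tl ys) = transport (transport y xs) ys"
proof -
  have "tr (transport y xs) (hd ys) = transport y xs"
    using transport_in[OF assms(1-3)] assms(5) tr_self by metis
  then show ?thesis using assms(4) by (cases ys) auto
qed

lemma transport_surj:
  assumes "y \<in> E"
  obtains xs where "eps_chain X \<epsilon> xs" "hd xs = b" "transport e xs = y"
proof -
  obtain c where c: "path c" "path_image c \<subseteq> E" "pathstart c = e" "pathfinish c = y"
    by (rule path_connected_cover[OF cover(3) assms]) (rule that)
  obtain n where n: "fine_mesh \<epsilon> (p \<circ> c) n" using ex_fine_mesh[OF path_p(1)[OF c(1,2)] eps_pos] by blast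
  show ?thesis
  proof
    show "eps_chain X \<epsilon> (path_chain (p \<circ> c) n)" by (rule eps_chain_path_chain[OF n path_p(2)[OF c(1,2)]])
    show "hd (path_chain (p \<circ> c) n) = b" using c(3) cover(4) by (simp add: pathstart_compose)
    show "transport e (path_chain (p \<circ> c) n) = y" using transport_path[OF c(1,2) n] c(3,4) by simp
  qed
qed

section \<open>The isometry\<close>

lemma eps_dist_transport:
  assumes xs: "eps_chain X \<epsilon> xs" "hd xs = b" and ys: "eps_chain X \<epsilon> ys" "hd ys = b"
  shows "ennreal (eps_dist X \<epsilon> b (eps_class X \<epsilon> xs) (eps_class X \<epsilon> ys)) =
    lifted_dist E p (transport e xs) (transport e ys)"
proof -
  let ?A = "eps_class X \<epsilon> (rev xs @ tl ys)" and ?x = "transport e xs" and ?y = "transport e ys"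
  have ne: "xs \<noteq> []" "ys \<noteq> []" using xs ys by (auto simp: eps_chain_def)
  have x: "?x \<in> E" "p ?x = last xs" and y: "?y \<in> E" "p ?y = last ys"
    using transport_in[of xs e] transport_in[of ys e] xs ys cover(3,4) by auto
  have ch: "eps_chain X \<epsilon> (rev xs @ tl ys)" "hd (rev xs @ tl ys) = last xs"
    using eps_chain_glue[of X \<epsilon> "rev xs" ys] xs ys ne by (auto simp: eps_chain_rev last_rev hd_rev)
  have canc: "eps_homotopic X \<epsilon> (xs @ tl (rev xs @ tl ys)) ys"
    using eps_homotopic_cancel_left[OF eps_pos, of X "rev xs" ys] xs ys ne by (simp add: eps_chain_rev last_rev)
  have dist: "eps_dist X \<epsilon> b (eps_class X \<epsilon> xs) (eps_class X \<epsilon> ys) = Inf (chain_length ` ?A)"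
    by (rule eps_dist_class) fact+
  show ?thesis
  proof (rule antisym)
    show "ennreal (eps_dist X \<epsilon> b (eps_class X \<epsilon> xs) (eps_class X \<epsilon> ys)) \<le> lifted_dist E p ?x ?y"
      unfolding lifted_dist_def
    proof (rule INF_greatest)
      fix c assume "c \<in> {c. path c \<and> path_image c \<subseteq> E \<and> pathstart c = ?x \<and> pathfinish c = ?y}"
      then have c: "path c" "path_image c \<subseteq> E" "pathstart c = ?x" "pathfinish c = ?y" by auto
      obtain n where n: "fine_mesh \<epsilon> (p \<circ> c) n" using ex_fine_mesh[OF path_p(1)[OF c(1,2)] eps_pos] by blast
      define \<gamma> where "\<gamma> = path_chain (p \<circ> c) n"
      have \<gamma>: "eps_chain X \<epsilon> \<gamma>" "hd \<gamma> = last xs" "transport ?x \<gamma> = ?y" "\<gamma> \<noteq> []"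
        using eps_chain_path_chain[OF n path_p(2)[OF c(1,2)]] c(3) x(2) transport_path[OF c(1,2) n] c(4)
        by (auto simp: \<gamma>_def pathstart_compose)
      have "transport e (xs @ tl \<gamma>) = ?y"
        using transport_glue[OF xs(1) _ cover(3) \<gamma>(4)] xs(2) cover(4) \<gamma>(2,3) by simp
      \<comment> \<open>Both chains transport \<open>e\<close> to \<open>?y\<close>, so injectivity
        applies; cancelling \<open>xs\<close> then puts the sample \<open>\<gamma>\<close> into the
        class over which the infimum is taken.\<close>
      then have h: "eps_homotopic X \<epsilon> (xs @ tl \<gamma>) ys"
        using xs ys \<gamma> ne by (intro transport_inj) (auto intro: eps_chain_glue)
      have "eps_homotopic X \<epsilon> (rev xs @ tl (xs @ tl \<gamma>)) (rev xs @ tl ys)"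
        by (rule eps_homotopic_glue2[OF h])
          (use xs \<gamma> ne in \<open>auto simp: eps_chain_rev last_rev intro: eps_chain_glue\<close>)
      moreover have "eps_homotopic X \<epsilon> (rev xs @ tl (xs @ tl \<gamma>)) \<gamma>"
        using eps_homotopic_cancel_left[OF eps_pos xs(1) \<gamma>(1)] \<gamma>(2) by simp
      ultimately have "\<gamma> \<in> ?A"
        unfolding eps_class_def by (auto intro: eps_homotopic_sym eps_homotopic_trans)
      then have "Inf (chain_length ` ?A) \<le> chain_length \<gamma>"
        by (intro cINF_lower bdd_below_chain_length)
      then have "ennreal (Inf (chain_length ` ?A)) \<le> ennreal (chain_length \<gamma>)" by (rule ennreal_leI)
      also have "\<dots> = ennreal (chain_length (map (p \<circ> c) (map (\<lambda>i. real i / real n) [0..<Suc n])))"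
        by (simp add: \<gamma>_def path_chain_def comp_def)
      also have "\<dots> \<le> path_length (p \<circ> c)"
      proof (rule chain_length_le_path_length)
        show "sorted (map (\<lambda>i. real i / real n) [0..<Suc n])"
          by (intro sorted_map_mono) (auto simp: monotone_on_def divide_right_mono simp del: upt_Suc)
        show "set (map (\<lambda>i. real i / real n) [0..<Suc n]) \<subseteq> {0..1}"
          by (auto simp: divide_le_eq)
      qed
      finally show "ennreal (eps_dist X \<epsilon> b (eps_class X \<epsilon> xs) (eps_class X \<epsilon> ys)) \<le> path_length (p \<circ> c)"
        unfolding dist .
    qed
  next
    have bound: "lifted_dist E p ?x ?y \<le> ennreal (chain_length \<gamma>)" if "\<gamma> \<in> ?A" for \<gamma>
    proof -
      have h: "eps_homotopic X \<epsilon> (rev xs @ tl ys) \<gamma>" using that by (simp add: eps_class_def)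
      then have \<gamma>: "eps_chain X \<epsilon> \<gamma>" "hd \<gamma> = last xs" using eps_homotopicD[OF h ch(1)] ch(2) by auto
      have "transport ?x \<gamma> = transport ?x (rev xs @ tl ys)"
        using transport_homotopic[OF h ch(1) _ x(1)] ch(2) x(2) by simp
      also have "\<dots> = transport e (xs @ tl (rev xs @ tl ys))"
        using transport_glue[OF xs(1) _ cover(3), of "rev xs @ tl ys"] ch(2) xs(2) cover(4) ne by simp
      also have "\<dots> = ?y"
        by (rule transport_homotopic[OF canc eps_chain_glue[OF xs(1) ch(1) ch(2)[symmetric]] _ cover(3)])
          (use xs(2) ne cover(4) in simp)
      finally have "transport ?x \<gamma> = ?y" .
      then obtain c where c: "path c" "path_image c \<subseteq> E" "pathstart c = ?x" "pathfinish c = ?y"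
        "path_length (p \<circ> c) \<le> ennreal (chain_length \<gamma>)"
        using transport_lift[OF \<gamma>(1) _ x(1)] \<gamma>(2) x(2) by metis
      then show ?thesis unfolding lifted_dist_def by (intro INF_lower2[of c]) auto
    qed
    have "rev xs @ tl ys \<in> ?A" by (simp add: eps_class_def)
    \<comment> \<open>One chain already makes the lifted distance finite, so the comparison with the
      infimum can take place in the reals.\<close>
    from bound[OF this] obtain r where r: "lifted_dist E p ?x ?y = ennreal r" "0 \<le> r"
      by (cases "lifted_dist E p ?x ?y") (auto simp: top_unique)
    have "r \<le> Inf (chain_length ` ?A)"
      using bound \<open>_ \<in> ?A\<close> r by (intro cINF_greatest) (auto simp: ennreal_le_iff)
    then show "lifted_dist E p ?x ?y \<le> ennreal (eps_dist X \<epsilon> b (eps_class X \<epsilon> xs) (eps_class X \<epsilon> ys))"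
      unfolding dist r(1) by (rule ennreal_leI)
  qed
qed

text \<open>The inverse of transport of \<open>e\<close> on classes; the class does not depend on
  the chosen chain, by \<open>transport_inj\<close>.\<close>

definition chain_map :: "'e \<Rightarrow> 'a list set" where
  "chain_map y = eps_class X \<epsilon> (SOME xs. eps_chain X \<epsilon> xs \<and> hd xs = b \<and> transport e xs = y)"

lemma chain_mapE:
  assumes "y \<in> E"
  obtains xs where "eps_chain X \<epsilon> xs" "hd xs = b" "transport e xs = y" "chain_map y = eps_class X \<epsilon> xs"
proof -
  let ?P = "\<lambda>xs. eps_chain X \<epsilon> xs \<and> hd xs = b \<and> transport e xs = y"
  have "\<exists>xs. ?P xs" by (rule transport_surj[OF assms]) blast
  then have "?P (SOME xs. ?P xs)" by (rule someI_ex)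
  then show ?thesis by (elim conjE) (rule that[of "SOME xs. ?P xs"], simp_all add: chain_map_def)
qed

lemma chain_map_transport:
  assumes "eps_chain X \<epsilon> xs" "hd xs = b"
  shows "chain_map (transport e xs) = eps_class X \<epsilon> xs"
proof -
  have "transport e xs \<in> E" using transport_in[OF assms(1)] assms(2) cover by simp
  then obtain ys where "eps_chain X \<epsilon> ys" "hd ys = b" "transport e ys = transport e xs"
    "chain_map (transport e xs) = eps_class X \<epsilon> ys"
    by (rule chain_mapE)
  then show ?thesis using transport_inj assms by (metis eps_class_eq_iff)
qed

lemma bij_betw_chain_map: "bij_betw chain_map E (eps_cover X \<epsilon> b)"
proof (rule bij_betw_imageI)
  show "inj_on chain_map E"
  proof (rule inj_onI)
    fix y z assume yz: "y \<in> E" "z \<in> E" "chain_map y = chain_map z"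
    obtain xs where xs: "eps_chain X \<epsilon> xs" "hd xs = b" "transport e xs = y" "chain_map y = eps_class X \<epsilon> xs"
      by (rule chain_mapE[OF yz(1)])
    obtain ys where ys: "eps_chain X \<epsilon> ys" "hd ys = b" "transport e ys = z" "chain_map z = eps_class X \<epsilon> ys"
      by (rule chain_mapE[OF yz(2)])
    have "eps_homotopic X \<epsilon> xs ys" using xs(4) ys(4) yz(3) eps_class_eq_iff by metis
    then show "y = z" using transport_homotopic[OF _ xs(1) _ cover(3)] xs ys cover(4) by metis
  qed
  show "chain_map ` E = eps_cover X \<epsilon> b"
  proof
    show "chain_map ` E \<subseteq> eps_cover X \<epsilon> b"
    proof
      fix A assume "A \<in> chain_map ` E"
      then obtain y where y: "y \<in> E" "A = chain_map y" by blast
      obtain xs where "eps_chain X \<epsilon> xs" "hd xs = b" "chain_map y = eps_class X \<epsilon> xs"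
        by (rule chain_mapE[OF y(1)])
      then show "A \<in> eps_cover X \<epsilon> b" using y(2) by (auto simp: eps_cover_def)
    qed
    show "eps_cover X \<epsilon> b \<subseteq> chain_map ` E"
    proof
      fix A assume "A \<in> eps_cover X \<epsilon> b"
      then obtain xs where xs: "eps_chain X \<epsilon> xs" "hd xs = b" "A = eps_class X \<epsilon> xs"
        by (auto simp: eps_cover_def)
      then have "A = chain_map (transport e xs)" by (simp add: chain_map_transport)
      moreover have "transport e xs \<in> E" using transport_in[OF xs(1)] xs(2) cover by simp
      ultimately show "A \<in> chain_map ` E" by blast
    qed
  qed
qed

lemma endpoint_chain_map: "y \<in> E \<Longrightarrow> eps_endpoint (chain_map y) = p y"
  by (erule chain_mapE) (use transport_in(2) cover in auto)

lemma eps_dist_chain_map: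
  assumes "y \<in> E" "z \<in> E"
  shows "ennreal (eps_dist X \<epsilon> b (chain_map y) (chain_map z)) = lifted_dist E p y z"
proof -
  obtain xs where "eps_chain X \<epsilon> xs" "hd xs = b" "transport e xs = y" "chain_map y = eps_class X \<epsilon> xs"
    by (rule chain_mapE[OF assms(1)])
  moreover obtain ys where "eps_chain X \<epsilon> ys" "hd ys = b" "transport e ys = z" "chain_map z = eps_class X \<epsilon> ys"
    by (rule chain_mapE[OF assms(2)])
  ultimately show ?thesis using eps_dist_transport by metis
qed

section \<open>The topology of \<open>E\<close> and the balls of the lifted length distance\<close>

lemma eps_dist_chain_map_less:
  assumes "y \<in> E" "z \<in> E" "r > 0"
  shows "eps_dist X \<epsilon> b (chain_map y) (chain_map z) < r \<longleftrightarrow> lifted_dist E p y z < ennreal r"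
  using eps_dist_chain_map[OF assms(1,2)] eps_dist_nonneg ennreal_less_iff by metis

text \<open>Inside a sheet the lifted geodesic from \<open>y\<close> bounds the lifted distance by
  the distance of the images, so the part of the sheet over \<open>ball (p y) r\<close> works. This
  gives continuity of \<open>chain_map\<close>.\<close>

lemma open_ball_lifted_dist:
  assumes "y \<in> E" "r > 0"
  shows "\<exists>U. openin (top_of_set E) U \<and> y \<in> U \<and> (\<forall>z\<in>U. lifted_dist E p y z < ennreal r)"
proof -
  obtain U q s where U: "openin (top_of_set E) U" "y \<in> U" "U \<subseteq> E" "homeomorphism U (ball (p y) s \<inter> X) p q"
    by (rule local_sheet[OF openin_subtopology_self assms(1)]) (rule that)
  have "openin (top_of_set E) (E \<inter> p -` ball (p y) r)"
    using covering_space_imp_continuous[OF cover(1)] by (simp add: continuous_openin_preimage_gen)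
  with U(1) have "openin (top_of_set E) (U \<inter> (E \<inter> p -` ball (p y) r))" by (rule openin_Int)
  moreover have "lifted_dist E p y z < ennreal r" if z: "z \<in> U \<inter> (E \<inter> p -` ball (p y) r)" for z
  proof -
    have "z \<in> U" using z by simp
    then obtain c where c: "path c" "path_image c \<subseteq> U" "pathstart c = y" "pathfinish c = z"
      "path_length (p \<circ> c) = ennreal (dist (p y) (p z))"
      by (rule sheet_geodesic[OF U(2) _ U(4,3)]) (rule that)
    then have "lifted_dist E p y z \<le> ennreal (dist (p y) (p z))"
      unfolding lifted_dist_def using U(3) by (intro INF_lower2[of c]) auto
    also have "\<dots> < ennreal r" using z assms(2) by (simp add: ennreal_less_iff)
    finally show ?thesis .
  qed
  ultimately show ?thesis using U(2) assms by (intro exI[of _ "U \<inter> (E \<inter> p -` ball (p y) r)"]) auto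
qed

text \<open>A path from \<open>y\<close> whose image is shorter than \<open>r\<close> projects into
  the ball under the sheet, so it cannot leave the sheet. This gives openness of
  \<open>chain_map\<close>.\<close>

lemma lifted_dist_ball_subset:
  assumes "openin (top_of_set E) W" "y \<in> W"
  shows "\<exists>r>0. \<forall>z\<in>E. lifted_dist E p y z < ennreal r \<longrightarrow> z \<in> W"
proof -
  obtain U q r where r: "r > 0" and U: "openin (top_of_set E) U" "y \<in> U" "U \<subseteq> W" "homeomorphism U (ball (p y) r \<inter> X) p q"
    by (rule local_sheet[OF assms]) (rule that)
  have UE: "U \<subseteq> E" using U(1) openin_imp_subset by blast
  have q: "continuous_on (ball (p y) r \<inter> X) q" "q ` (ball (p y) r \<inter> X) = U"
    "\<And>x. x \<in> ball (p y) r \<inter> X \<Longrightarrow> p (q x) = x" "q (p y) = y"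
    using U(2,4) by (auto simp: homeomorphism_def)
  have "z \<in> W" if less: "lifted_dist E p y z < ennreal r" for z
  proof -
    obtain c where c: "path c" "path_image c \<subseteq> E" "pathstart c = y" "pathfinish c = z"
      "path_length (p \<circ> c) < ennreal r"
      using less unfolding lifted_dist_def by (auto simp: INF_less_iff)
    have im: "p (c t) \<in> ball (p y) r \<inter> X" if "t \<in> {0..1}" for t
    proof
      have "ennreal (chain_length (map (p \<circ> c) [0, t])) < ennreal r"
        using chain_length_le_path_length[of "[0, t]" "p \<circ> c"] that c(5) by (auto intro: le_less_trans)
      then show "p (c t) \<in> ball (p y) r"
        using c(3) r by (simp add: ennreal_less_iff pathstart_def)
      show "p (c t) \<in> X" by (intro p_in subsetD[OF c(2)]) (use that in \<open>simp add: path_image_def\<close>)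
    qed
    then have sub: "path_image (p \<circ> c) \<subseteq> ball (p y) r \<inter> X" unfolding path_image_def by auto
    have path: "path (q \<circ> (p \<circ> c))"
      by (rule path_continuous_image[OF path_p(1)[OF c(1,2)] continuous_on_subset[OF q(1) sub]])
    have qU: "path_image (q \<circ> (p \<circ> c)) \<subseteq> U"
      using sub q(2) unfolding path_image_compose[of q] by blast
    \<comment> \<open>Projecting \<open>c\<close> and lifting back through the sheet gives a second
      lift from \<open>y\<close>; uniqueness makes it equal to \<open>c\<close>, so the endpoint
      lies in \<open>U\<close>.\<close>
    have "(q \<circ> (p \<circ> c)) 1 = c 1"
      by (rule lift_unique[OF path _ c(1,2)])
        (use qU UE im q(3,4) c(3) in \<open>auto simp: pathstart_def\<close>)
    then have "z = pathfinish (q \<circ> (p \<circ> c))" using c(4) by (simp add: pathfinish_def)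
    then show "z \<in> W" using subsetD[OF qU pathfinish_in_path_image] U(3) by auto
  qed
  then show ?thesis using r by blast
qed

lemma homeomorphic_chain_map:
  "homeomorphic_map (top_of_set E) (eps_topology X \<epsilon> b) chain_map"
proof -
  interpret M: Metric_space "eps_cover X \<epsilon> b" "eps_dist X \<epsilon> b" by (rule Metric_space_eps_cover[OF eps_pos])
  note bij = bij_betw_chain_map
  show ?thesis
  proof (rule bijective_open_imp_homeomorphic_map)
    show "continuous_map (top_of_set E) M.mtopology chain_map"
      unfolding continuous_map_def
    proof (intro conjI allI impI)
      show "chain_map \<in> topspace (top_of_set E) \<rightarrow> topspace M.mtopology"
        using bij by (auto simp: bij_betw_def)
      fix V assume V: "openin M.mtopology V"
      show "openin (top_of_set E) {y \<in> topspace (top_of_set E). chain_map y \<in> V}"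
      proof (subst openin_subopen, intro ballI)
        fix y assume "y \<in> {y \<in> topspace (top_of_set E). chain_map y \<in> V}"
        then have y: "y \<in> E" "chain_map y \<in> V" by auto
        then obtain r where r: "r > 0" "M.mball (chain_map y) r \<subseteq> V"
          using V unfolding M.openin_mtopology by blast
        obtain U where U: "openin (top_of_set E) U" "y \<in> U" "\<forall>z\<in>U. lifted_dist E p y z < ennreal r"
          using open_ball_lifted_dist[OF y(1) r(1)] by blast
        have UE: "U \<subseteq> E" using U(1) openin_imp_subset by blast
        have "chain_map z \<in> V" if "z \<in> U" for z
        proof -
          have z: "z \<in> E" using UE that by blast
          then have "eps_dist X \<epsilon> b (chain_map y) (chain_map z) < r"
            using U(3) that eps_dist_chain_map_less[OF y(1) z r(1)] by blast
          moreover have "chain_map y \<in> eps_cover X \<epsilon> b" "chain_map z \<in> eps_cover X \<epsilon> b"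
            using bij_betwE[OF bij] y(1) z by auto
          ultimately show ?thesis using r(2) by (auto simp: M.mball_def)
        qed
        then show "\<exists>T. openin (top_of_set E) T \<and> y \<in> T \<and> T \<subseteq> {y \<in> topspace (top_of_set E). chain_map y \<in> V}"
          using U(1,2) UE by auto
      qed
    qed
    show "open_map (top_of_set E) M.mtopology chain_map"
      unfolding open_map_def
    proof (intro allI impI)
      fix W assume W: "openin (top_of_set E) W"
      then have WE: "W \<subseteq> E" by (rule openin_imp_subset)
      show "openin M.mtopology (chain_map ` W)"
        unfolding M.openin_mtopology
      proof (intro conjI allI impI)
        show "chain_map ` W \<subseteq> eps_cover X \<epsilon> b" using WE bij_betwE[OF bij] by blast
        fix A assume "A \<in> chain_map ` W"
        then obtain y where y: "y \<in> W" "A = chain_map y" by blast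
        obtain r where r: "r > 0" "\<forall>z\<in>E. lifted_dist E p y z < ennreal r \<longrightarrow> z \<in> W"
          using lifted_dist_ball_subset[OF W y(1)] by blast
        have "M.mball A r \<subseteq> chain_map ` W"
        proof
          fix B assume "B \<in> M.mball A r"
          then have B: "B \<in> eps_cover X \<epsilon> b" "eps_dist X \<epsilon> b A B < r" by (auto simp: M.mball_def)
          then obtain z where z: "z \<in> E" "B = chain_map z" using bij_betw_imp_surj_on[OF bij] by blast
          have "y \<in> E" using y(1) WE by blast
          then have "z \<in> W" using r z B(2) y(2) eps_dist_chain_map_less[of y z r] by blast
          then show "B \<in> chain_map ` W" using z(2) by blast
        qed
        then show "\<exists>r>0. M.mball A r \<subseteq> chain_map ` W" using r(1) by blast
      qed
    qed
    show "chain_map ` topspace (top_of_set E) = topspace M.mtopology"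
      using bij by (simp add: bij_betw_def)
    show "inj_on chain_map (topspace (top_of_set E))"
      using bij by (simp add: bij_betw_def)
  qed
qed

end

theorem corollary17:
  fixes X :: "'a::metric_space set" and b :: 'a and \<epsilon> \<delta> :: real
    and E :: "'e::topological_space set" and p :: "'e \<Rightarrow> 'a" and e :: 'e
  assumes "geodesic_space X" and "b \<in> X"
    and "\<delta> = 3 * \<epsilon> / 2" and "\<delta> > 0"
    and "delta_cover X b \<delta> E p e"
  shows "\<exists>h. homeomorphic_map (top_of_set E) (eps_topology X \<epsilon> b) h \<and>
             (\<forall>y\<in>E. eps_endpoint (h y) = p y) \<and>
             (\<forall>x\<in>E. \<forall>y\<in>E. ennreal (eps_dist X \<epsilon> b (h x) (h y)) = lifted_dist E p x y)"
proof -
  have "\<epsilon> > 0" using assms(3,4) by linarith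
  moreover have "delta_cover X b (3 * \<epsilon> / 2) E p e" using assms(5) unfolding assms(3) .
  ultimately interpret small_loop_cover X b \<epsilon> E p e by (rule small_loop_cover.intro[OF assms(1,2)])
  show ?thesis
    by (intro exI[of _ chain_map] conjI ballI homeomorphic_chain_map endpoint_chain_map eps_dist_chain_map)
qed

end
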